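(* There exist universal constants $c>0$, $C'\ge0$ such that for any integer $d>1$ there exist two distributions $D$ and $P$ over $\mathbb{R}^d\times\{\pm1\}$ whose marginals $D_X,P_X$ have identical covariance matrices, such that for all $\epsilon,\delta\in(0,\frac14)$, $m(\epsilon,1,P,\delta)\ge c\,d-C'$ while $m(\epsilon,1,D,\delta)\le\lceil\log_2(1/\delta)\rceil$. Moreover, $D_X$ and $P_X$ are sub-Gaussian with relative moment $\sqrt2$ in all directions, i.e., for $X\sim D_X$ or $X\sim P_X$ and every $u\in\mathbb{R}^d$, $\langle u,X\rangle$ is sub-Gaussian with relative moment $\sqrt2$.
   Context: Hypothesis class $\mathcal{W}=\{x\mapsto\langle w,x\rangle\mid\|w\|\le1\}$. For $h$: $\ell_0(h,D)=\mathbb{P}_{(X,Y)\sim D}[Yh(X)\le0]$, $\ell_\gamma(h,D)=\mathbb{P}[Yh(X)\le\gamma]$, $\ell^*_\gamma(D)=\inf_{h\in\mathcal{W}}\ell_\gamma(h,D)$; for a labeled sample $S$ of size $n$, $\ell_\gamma(h,S)=\frac1n|\{i:y_ih(x_i)\le\gamma\}|$. A learning algorithm maps finite labeled samples to functions; $\ell_0(\mathcal{A},D,n,\delta)=\inf\{\epsilon\ge0\mid\mathbb{P}_{S\sim D^n}[\ell_0(\mathcal{A}(S),D)\ge\epsilon]\le\delta\}$. An MEM algorithm $\mathcal{A}$ maps each $\gamma>0$ to $\mathcal{A}_\gamma$ with $\mathcal{A}_\gamma(S)\in\arg\min_{h\in\mathcal{W}}\ell_\gamma(h,S)$. The sample complexity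 $m(\epsilon,\gamma,D,\delta)$ is the minimal $m_0$ such that for every MEM algorithm and every $n\ge m_0$, $\ell_0(\mathcal{A}_\gamma,D,n,\delta)-\ell^*_\gamma(D)\le\epsilon$. A real random variable $Z$ is sub-Gaussian with relative moment $\rho$ if $\mathbb{E}[\exp(tZ)]\le\exp(t^2\rho^2\mathbb{E}[Z^2]/2)$ for all $t\in\mathbb{R}$. *)

theory Defs
  imports "HOL-Probability.Probability"
begin

text \<open>Points of R^d are functions nat => real, extensional on {..<d}
  (the space of PiM {..<d} (\<lambda>_. borel)).  Labels are reals in {-1,1}.\<close>

type_synonym point = "nat \<Rightarrow> real"
type_synonym example = "point \<times> real"
type_synonym sample = "nat \<Rightarrow> example"
type_synonym hyp = "point \<Rightarrow> real"

definition Zd :: "nat \<Rightarrow> example measure" where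
  "Zd d = (PiM {..<d} (\<lambda>_. borel)) \<Otimes>\<^sub>M count_space {-1, 1}"

definition is_distr :: "nat \<Rightarrow> example measure \<Rightarrow> bool" where
  "is_distr d D \<longleftrightarrow> prob_space D \<and> sets D = sets (Zd d)"

definition ip :: "nat \<Rightarrow> point \<Rightarrow> point \<Rightarrow> real" where
  "ip d w x = (\<Sum>i<d. w i * x i)"

definition W :: "nat \<Rightarrow> hyp set" where
  "W d = {(\<lambda>x. ip d w x) | w. (\<Sum>i<d. (w i)\<^sup>2) \<le> 1}"

definition loss :: "real \<Rightarrow> hyp \<Rightarrow> example measure \<Rightarrow> real" where
  "loss \<gamma> h D = measure D {z \<in> space D. snd z * h (fst z) \<le> \<gamma>}"

definition opt_loss :: "nat \<Rightarrow> real \<Rightarrow> example measure \<Rightarrow> real" where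
  "opt_loss d \<gamma> D = (INF h \<in> W d. loss \<gamma> h D)"

definition emp_loss :: "real \<Rightarrow> hyp \<Rightarrow> nat \<Rightarrow> sample \<Rightarrow> real" where
  "emp_loss \<gamma> h n S = real (card {i \<in> {..<n}. snd (S i) * h (fst (S i)) \<le> \<gamma>}) / real n"

text \<open>A learning algorithm maps a sample size n and a sample (S 0, ..., S (n-1)) to a function.\<close>
type_synonym alg = "nat \<Rightarrow> sample \<Rightarrow> hyp"

text \<open>A is a margin-error-minimising algorithm for margin gamma (the component A_gamma
  of an MEM algorithm): on every finite labeled sample it returns an element of W
  minimising the empirical gamma-margin loss.\<close>
definition mem_alg :: "nat \<Rightarrow> real \<Rightarrow> alg \<Rightarrow> bool" where
  "mem_alg d \<gamma> A \<longleftrightarrow> (\<forall>n S. (\<forall>i<n. S i \<in> space (Zd d)) \<longrightarrow>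
      A n S \<in> W d \<and> (\<forall>h\<in>W d. emp_loss \<gamma> (A n S) n S \<le> emp_loss \<gamma> h n S))"

text \<open>Outer probability (the event need not be measurable for arbitrary algorithms).\<close>
definition outer_prob :: "'a measure \<Rightarrow> 'a set \<Rightarrow> real" where
  "outer_prob M E = (INF A \<in> {A \<in> sets M. E \<subseteq> A}. measure M A)"

definition err_alg :: "alg \<Rightarrow> example measure \<Rightarrow> nat \<Rightarrow> real \<Rightarrow> real" where
  "err_alg A D n \<delta> = Inf {\<epsilon>. \<epsilon> \<ge> 0 \<and>
     outer_prob (PiM {..<n} (\<lambda>_. D))
       {S \<in> space (PiM {..<n} (\<lambda>_. D)). loss 0 (A n S) D \<ge> \<epsilon>} \<le> \<delta>}"

definition sc_good :: "nat \<Rightarrow> real \<Rightarrow> real \<Rightarrow> example measure \<Rightarrow> real \<Rightarrow> nat \<Rightarrow> bool" where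
  "sc_good d \<epsilon> \<gamma> D \<delta> m0 \<longleftrightarrow>
     (\<forall>A. mem_alg d \<gamma> A \<longrightarrow> (\<forall>n\<ge>m0. err_alg A D n \<delta> - opt_loss d \<gamma> D \<le> \<epsilon>))"

definition samp_compl :: "nat \<Rightarrow> real \<Rightarrow> real \<Rightarrow> example measure \<Rightarrow> real \<Rightarrow> ereal" where
  "samp_compl d \<epsilon> \<gamma> D \<delta> =
     (if \<exists>m0. sc_good d \<epsilon> \<gamma> D \<delta> m0
      then ereal (real (LEAST m0. sc_good d \<epsilon> \<gamma> D \<delta> m0)) else \<infinity>)"

definition subgauss_rel :: "'a measure \<Rightarrow> ('a \<Rightarrow> real) \<Rightarrow> real \<Rightarrow> bool" where
  "subgauss_rel M Z \<rho> \<longleftrightarrow> integrable M (\<lambda>x. (Z x)\<^sup>2) \<and>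
     (\<forall>t::real. (\<integral>\<^sup>+ x. ennreal (exp (t * Z x)) \<partial>M)
        \<le> ennreal (exp (t\<^sup>2 * \<rho>\<^sup>2 * (\<integral>x. (Z x)\<^sup>2 \<partial>M) / 2)))"

definition cov_X :: "example measure \<Rightarrow> nat \<Rightarrow> nat \<Rightarrow> real" where
  "cov_X D i j = (\<integral>z. fst z i * fst z j \<partial>D) - (\<integral>z. fst z i \<partial>D) * (\<integral>z. fst z j \<partial>D)"

end

theory Submission
  imports Defs
begin

text \<open>
  Both distributions have the same marginal: the coordinates are i.i.d. uniform on
  $\{\pm 3/8, \pm 9/8\}$, so the variance is $45/64$ in every unit direction and the moment generating
  function is at most $\exp(\frac{9}{8}^2 t^2/2) \le \exp(2 \cdot \frac{45}{64} t^2/2)$.  Only the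
  labels differ.

  In \<open>D\<close> the label is an independent fair coin.  Then $\ell_0(w) = (1 + P[\langle w,X\rangle = 0])/2
  \le 5/8$ for every $w \ne 0$, since a coordinate with $w_i \ne 0$ has no atom larger than $1/4$,
  while by Chebyshev $\ell_1(w) = (1 + P[|\langle w,X\rangle| \le 1])/2 \ge 83/128 > 5/8$ for
  $\|w\| \le 1$.  A minimiser is non-zero as soon as one sample point has $|x_0| = 9/8$, which fails
  with probability $2^{-n}$.

  In \<open>P\<close> the label is the sign of $x_0$, so that $\ell^*_1(P) \le 1/2$.  For $n \le d/20000$ there is,
  with probability at least $1/2$, a vector $u$ with $u_0 = 0$, $\|u\|^2 < 1/80$ and
  $\langle u,x_i\rangle = 2 y_i$ on the sample; then $w = u - e_0/2$ classifies the sample with margin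
  above $1$, but errs on a fresh point with probability at least $3/4$.  To find $u$, add the sample
  points one at a time and correct $u$ along the component $q$ of the new point orthogonal to $e_0$ and
  to the previous points.  Chebyshev's inequality for the quadratic form $\|x\|^2 - \|q\|^2$ gives
  $\|q\|^2 \ge c d$ up to probability $O(1/d)$, so that each step raises the expected truncated
  squared norm of $u$ by $O(1/d)$ only.
\<close>

section \<open>Moments of the marginal\<close>

text \<open>The outer value \<open>9/8\<close> exceeds the margin 1, so one coordinate of weight 1
  can beat it. The inner value \<open>3/8\<close> lowers the second moment to
  \<open>45/64 < 1\<close>, which makes Chebyshev's inequality at threshold 1 informative, and
  bounds the support away from 0.\<close>

definition coord_pmf :: "real pmf" where
  "coord_pmf = pmf_of_set {- 9/8, - 3/8, 3/8, 9/8}"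

definition cube_pmf :: "nat \<Rightarrow> point pmf" where
  "cube_pmf d = Pi_pmf {..<d} 0 (\<lambda>_. coord_pmf)"

lemma set_coord_pmf: "set_pmf coord_pmf = {- 9/8, - 3/8, 3/8, 9/8}"
  by (simp add: coord_pmf_def)

lemma expectation_coord_pmf:
  fixes f :: "real \<Rightarrow> real"
  shows "measure_pmf.expectation coord_pmf f = (f (- 9/8) + f (- 3/8) + f (3/8) + f (9/8)) / 4"
  by (simp add: coord_pmf_def integral_pmf_of_set)

lemma finite_set_Pi_pmf:
  "finite A \<Longrightarrow> (\<And>i. i \<in> A \<Longrightarrow> finite (set_pmf (p i))) \<Longrightarrow> finite (set_pmf (Pi_pmf A dflt p))"
  by (simp add: set_Pi_pmf finite_PiE_dflt)

lemma finite_set_cube_pmf [simp]: "finite (set_pmf (cube_pmf d))"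
  by (simp add: cube_pmf_def finite_set_Pi_pmf set_coord_pmf)

lemma integrable_cube_pmf [simp]: "integrable (measure_pmf (cube_pmf d)) (f :: point \<Rightarrow> real)"
  by (rule integrable_measure_pmf_finite) simp

lemma expectation_pair_pmf_finite:
  fixes f :: "'a \<times> 'b \<Rightarrow> real"
  assumes "finite (set_pmf p)" "finite (set_pmf q)"
  shows "measure_pmf.expectation (pair_pmf p q) f
       = measure_pmf.expectation q (\<lambda>y. measure_pmf.expectation p (\<lambda>x. f (x, y)))"
proof -
  have "measure_pmf.expectation (pair_pmf p q) f
      = (\<Sum>z\<in>set_pmf p \<times> set_pmf q. f z * pmf (pair_pmf p q) z)"
    by (rule integral_measure_pmf_real) (use assms in auto)
  also have "\<dots> = (\<Sum>x\<in>set_pmf p. \<Sum>y\<in>set_pmf q. f (x, y) * (pmf p x * pmf q y))"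
    by (subst sum.cartesian_product) (auto simp: pmf_pair intro!: sum.cong)
  also have "\<dots> = (\<Sum>y\<in>set_pmf q. (\<Sum>x\<in>set_pmf p. f (x, y) * pmf p x) * pmf q y)"
    by (subst sum.swap) (simp add: sum_distrib_right sum_distrib_left mult_ac)
  also have "\<dots> = (\<Sum>y\<in>set_pmf q. measure_pmf.expectation p (\<lambda>x. f (x, y)) * pmf q y)"
    by (intro sum.cong refl arg_cong2[where f="(*)"] integral_measure_pmf_real[symmetric])
      (use assms in auto)
  also have "\<dots> = measure_pmf.expectation q (\<lambda>y. measure_pmf.expectation p (\<lambda>x. f (x, y)))"
    by (rule integral_measure_pmf_real[symmetric]) (use assms in auto)
  finally show ?thesis .
qed

lemma expectation_Pi_pmf_insert:
  fixes f :: "('i \<Rightarrow> 'b) \<Rightarrow> real"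
  assumes "finite A" "i \<notin> A" "finite (set_pmf p)"
  shows "measure_pmf.expectation (Pi_pmf (insert i A) dflt (\<lambda>_. p)) f
       = measure_pmf.expectation (Pi_pmf A dflt (\<lambda>_. p))
           (\<lambda>x. measure_pmf.expectation p (\<lambda>y. f (x(i := y))))"
  using assms
  by (simp add: Pi_pmf_insert expectation_pair_pmf_finite finite_set_Pi_pmf)

lemma expectation_cube_pmf_Suc:
  fixes f :: "point \<Rightarrow> real"
  shows "measure_pmf.expectation (cube_pmf (Suc d)) f
       = measure_pmf.expectation (cube_pmf d)
           (\<lambda>x. (f (x(d := - 9/8)) + f (x(d := - 3/8)) + f (x(d := 3/8)) + f (x(d := 9/8))) / 4)"
  unfolding cube_pmf_def lessThan_Suc
  by (subst expectation_Pi_pmf_insert) (simp_all add: set_coord_pmf expectation_coord_pmf)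

lemma ip_upd: "d \<le> k \<Longrightarrow> ip d w (x(k := y)) = ip d w x"
  by (auto simp: ip_def intro!: sum.cong)

lemma ip_Suc: "ip (Suc d) w x = ip d w x + w d * x d"
  by (simp add: ip_def)

text \<open>The last coordinate is centred, so averaging over it removes the cross term and adds
  only its variance \<open>45/64\<close> times the squared weight.\<close>

lemma second_moment_ip:
  "measure_pmf.expectation (cube_pmf d) (\<lambda>x. (ip d w x)\<^sup>2) = 45/64 * (\<Sum>i<d. (w i)\<^sup>2)"
proof (induction d)
  case 0
  then show ?case by (simp add: ip_def)
next
  case (Suc d)
  have "measure_pmf.expectation (cube_pmf (Suc d)) (\<lambda>x. (ip (Suc d) w x)\<^sup>2)
     = measure_pmf.expectation (cube_pmf d) (\<lambda>x. (ip d w x)\<^sup>2 + 45/64 * (w d)\<^sup>2)"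
    unfolding expectation_cube_pmf_Suc
    by (intro Bochner_Integration.integral_cong refl)
      (simp add: ip_Suc ip_upd power2_eq_square field_simps)
  also have "\<dots> = 45/64 * (\<Sum>i<Suc d. (w i)\<^sup>2)"
    by (simp add: Suc algebra_simps)
  finally show ?case .
qed

text \<open>\<open>quad_dev d A x\<close> is the quadratic form of \<open>A\<close> at \<open>x\<close> minus its mean under \<open>cube_pmf d\<close>.\<close>

definition quad_dev :: "nat \<Rightarrow> (nat \<Rightarrow> nat \<Rightarrow> real) \<Rightarrow> point \<Rightarrow> real" where
  "quad_dev d A x = (\<Sum>i<d. \<Sum>j<d. A i j * x i * x j) - 45/64 * (\<Sum>i<d. A i i)"

lemma quad_dev_Suc:
  assumes "\<And>i j. A i j = A j i"
  shows "quad_dev (Suc d) A (x(d := y))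
    = quad_dev d A x + y * ip d (\<lambda>i. 2 * A i d) x + A d d * (y\<^sup>2 - 45/64)"
proof -
  have 1: "(\<Sum>i<d. \<Sum>j<d. A i j * (x(d := y)) i * (x(d := y)) j) = (\<Sum>i<d. \<Sum>j<d. A i j * x i * x j)"
    by (intro sum.cong) auto
  have 2: "(\<Sum>i<d. A i d * (x(d := y)) i * y) = (\<Sum>i<d. A i d * x i * y)"
    by (intro sum.cong) auto
  have 3: "(\<Sum>j<d. A d j * y * (x(d := y)) j) = (\<Sum>i<d. A i d * x i * y)"
    using assms by (intro sum.cong) auto
  show ?thesis
    using 1 2 3
    by (simp add: quad_dev_def ip_def sum.distrib sum_distrib_left sum_distrib_right algebra_simps
        power2_eq_square)
qed

text \<open>With \<open>y\<close> the last coordinate, \<open>y\<close>, \<open>y^2 - 45/64\<close>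
  and their product all have mean zero, so only three squares survive the averaging. The linear one
  has constant \<open>100\<close>; it becomes \<open>50\<close> because each off-diagonal entry is
  counted twice in the Frobenius norm.\<close>

lemma second_moment_quad_dev:
  assumes sym: "\<And>i j. A i j = A j i"
  shows "measure_pmf.expectation (cube_pmf d) (\<lambda>x. (quad_dev d A x)\<^sup>2)
       \<le> 50 * (9/64)\<^sup>2 * (\<Sum>i<d. \<Sum>j<d. (A i j)\<^sup>2)"
proof (induction d)
  case 0
  then show ?case by (simp add: quad_dev_def)
next
  case (Suc d)
  have col: "(\<Sum>i<d. (2 * A i d)\<^sup>2) = 4 * (\<Sum>i<d. (A i d)\<^sup>2)"
    unfolding sum_distrib_left by (rule sum.cong) (simp_all add: power_mult_distrib)
  have row: "(\<Sum>j<d. (A d j)\<^sup>2) = (\<Sum>i<d. (A i d)\<^sup>2)"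
    unfolding sym[of d] ..
  have lin: "measure_pmf.expectation (cube_pmf d) (\<lambda>x. (ip d (\<lambda>i. 2 * A i d) x)\<^sup>2)
     = 45/64 * (4 * (\<Sum>i<d. (A i d)\<^sup>2))"
    by (simp only: second_moment_ip col)
  have "measure_pmf.expectation (cube_pmf (Suc d)) (\<lambda>x. (quad_dev (Suc d) A x)\<^sup>2)
     = measure_pmf.expectation (cube_pmf d) (\<lambda>x. (quad_dev d A x)\<^sup>2
         + 45/64 * (ip d (\<lambda>i. 2 * A i d) x)\<^sup>2 + 16 * (9/64)\<^sup>2 * (A d d)\<^sup>2)"
    unfolding expectation_cube_pmf_Suc
    by (intro Bochner_Integration.integral_cong refl)
      (simp add: quad_dev_Suc[OF sym] power2_eq_square field_simps)
  also have "\<dots> = measure_pmf.expectation (cube_pmf d) (\<lambda>x. (quad_dev d A x)\<^sup>2)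
         + 100 * (9/64)\<^sup>2 * (\<Sum>i<d. (A i d)\<^sup>2) + 16 * (9/64)\<^sup>2 * (A d d)\<^sup>2"
    by (simp add: lin) (simp add: power2_eq_square)
  \<comment> \<open>The diagonal constant \<open>16\<close> is weakened to \<open>50\<close>, so
    that all entries share one constant.\<close>
  also have "\<dots> \<le> 50 * (9/64)\<^sup>2 * (\<Sum>i<d. \<Sum>j<d. (A i j)\<^sup>2)
         + 100 * (9/64)\<^sup>2 * (\<Sum>i<d. (A i d)\<^sup>2) + 50 * (9/64)\<^sup>2 * (A d d)\<^sup>2"
    by (rule add_mono[OF add_right_mono[OF Suc.IH] mult_right_mono]) simp_all
  also have "\<dots> = 50 * (9/64)\<^sup>2 * ((\<Sum>i<d. \<Sum>j<d. (A i j)\<^sup>2)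
         + (\<Sum>i<d. (A i d)\<^sup>2) + (\<Sum>i<d. (A i d)\<^sup>2) + (A d d)\<^sup>2)"
    by (simp only: distrib_left)
  also have "\<dots> = 50 * (9/64)\<^sup>2 * (\<Sum>i<Suc d. \<Sum>j<Suc d. (A i j)\<^sup>2)"
    by (simp add: sum.distrib row)
  finally show ?case .
qed

section \<open>Interpolation of a growing sample\<close>

lemma ip_commute: "ip d u v = ip d v u"
  by (simp add: ip_def mult.commute)

lemma ip_add_left: "ip d (\<lambda>i. u i + v i) w = ip d u w + ip d v w"
  by (simp add: ip_def sum.distrib algebra_simps)

lemma ip_diff_left: "ip d (\<lambda>i. u i - v i) w = ip d u w - ip d v w"
  by (simp add: ip_def sum_subtractf algebra_simps)

lemma ip_diff_right: "ip d w (\<lambda>i. u i - v i) = ip d w u - ip d w v"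
  by (simp add: ip_def sum_subtractf algebra_simps)

lemma ip_scale_left: "ip d (\<lambda>i. c * u i) w = c * ip d u w"
  by (simp add: ip_def sum_distrib_left mult.assoc)

lemma ip_scale_right: "ip d w (\<lambda>i. c * u i) = c * ip d w u"
  by (simp add: ip_def sum_distrib_left mult.left_commute)

lemma ip_sum_left: "ip d (\<lambda>i. \<Sum>m\<in>M. f m i) w = (\<Sum>m\<in>M. ip d (f m) w)"
  unfolding ip_def sum_distrib_right by (rule sum.swap)

lemma ip_self: "ip d u u = (\<Sum>i<d. (u i)\<^sup>2)"
  by (simp add: ip_def power2_eq_square)

lemma ip_self_nonneg [simp]: "0 \<le> ip d u u"
  by (simp add: ip_self sum_nonneg)

text \<open>Points may be nonzero outside \<open>{..<d}\<close>, so a vanishing norm yields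
  orthogonality to everything rather than \<open>u = 0\<close>.\<close>

lemma ip_eq_0_if_self_eq_0:
  assumes "ip d u u = 0"
  shows "ip d u v = 0"
proof -
  have "u i = 0" if "i < d" for i
    using assms that by (simp add: ip_self sum_nonneg_eq_0_iff)
  then show ?thesis
    by (simp add: ip_def)
qed

section \<open>Orthonormal families and projections\<close>

definition orthonormal :: "nat \<Rightarrow> nat \<Rightarrow> (nat \<Rightarrow> point) \<Rightarrow> bool" where
  "orthonormal d r e \<longleftrightarrow> (\<forall>i<r. \<forall>j<r. ip d (e i) (e j) = (if i = j then 1 else 0))"

text \<open>For an orthonormal family \<open>e\<close>, this is the component of \<open>x\<close>
  orthogonal to its span.\<close>

definition resid :: "nat \<Rightarrow> nat \<Rightarrow> (nat \<Rightarrow> point) \<Rightarrow> point \<Rightarrow> point" where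
  "resid d r e x = (\<lambda>i. x i - (\<Sum>m<r. ip d (e m) x * e m i))"

lemma ip_resid: "ip d (resid d r e x) u = ip d x u - (\<Sum>m<r. ip d (e m) x * ip d (e m) u)"
  by (simp add: resid_def ip_diff_left ip_sum_left ip_scale_left)

lemma ip_resid_perp:
  "(\<And>m. m < r \<Longrightarrow> ip d (e m) u = 0) \<Longrightarrow> ip d (resid d r e x) u = ip d x u"
  by (simp add: ip_resid)

lemma resid_perp:
  assumes "orthonormal d r e" "k < r"
  shows "ip d (e k) (resid d r e x) = 0"
proof -
  have "(\<Sum>m<r. ip d (e m) x * ip d (e m) (e k)) = (\<Sum>m<r. if m = k then ip d (e k) x else 0)"
    using assms by (intro sum.cong) (auto simp: orthonormal_def)
  also have "\<dots> = ip d (e k) x"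
    using assms by simp
  finally show ?thesis
    by (subst ip_commute) (simp add: ip_resid ip_commute[of d x])
qed

lemma ip_resid_self:
  assumes "orthonormal d r e"
  shows "ip d (resid d r e x) (resid d r e x) = ip d x x - (\<Sum>m<r. (ip d (e m) x)\<^sup>2)"
proof -
  have "ip d (resid d r e x) (resid d r e x) = ip d x (resid d r e x)"
    by (rule ip_resid_perp) (simp add: resid_perp assms)
  also have "\<dots> = ip d x x - (\<Sum>m<r. (ip d (e m) x)\<^sup>2)"
    by (subst ip_commute) (simp add: ip_resid power2_eq_square)
  finally show ?thesis .
qed

text \<open>Containment of the \<open>v i\<close> in the span of \<open>e\<close> is expressed
  dually, through orthogonal vectors; this is the only form in which it is needed. Dependent vectors
  are skipped, hence \<open>r \<le> n\<close>.\<close>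

lemma gram_schmidt:
  "\<exists>r e. r \<le> n \<and> orthonormal d r e \<and>
     (\<forall>u. (\<forall>m<r. ip d (e m) u = 0) \<longrightarrow> (\<forall>i<n. ip d (v i) u = 0))"
proof (induction n)
  case 0
  then show ?case by (auto simp: orthonormal_def)
next
  case (Suc n)
  then obtain r e where r: "r \<le> n" and e: "orthonormal d r e"
    and perp: "\<And>u i. (\<And>m. m < r \<Longrightarrow> ip d (e m) u = 0) \<Longrightarrow> i < n \<Longrightarrow> ip d (v i) u = 0"
    by blast
  define q where "q = resid d r e (v n)"
  have qe: "ip d (e k) q = 0" if "k < r" for k
    using resid_perp[OF e that] by (simp add: q_def)
  have vq: "ip d (v n) u = ip d q u" if "\<And>m. m < r \<Longrightarrow> ip d (e m) u = 0" for u
    using ip_resid_perp[OF that] by (simp add: q_def)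
  show ?case
  proof (cases "ip d q q = 0")
    case True
    have "ip d (v i) u = 0" if "\<And>m. m < r \<Longrightarrow> ip d (e m) u = 0" "i < Suc n" for u i
      using that perp[of u i] vq[of u] ip_eq_0_if_self_eq_0[OF True, of u]
      by (cases "i = n") auto
    with r e show ?thesis
      by (intro exI[of _ r] exI[of _ e]) auto
  next
    case False
    define c where "c = 1 / sqrt (ip d q q)"
    have c: "c * c * ip d q q = 1" "c \<noteq> 0"
      using False by (auto simp: c_def)
    define e' where "e' = e(r := (\<lambda>i. c * q i))"
    have "orthonormal d (Suc r) e'"
      unfolding orthonormal_def
    proof (intro allI impI)
      fix i j assume "i < Suc r" "j < Suc r"
      moreover have "ip d q (e k) = 0" if "k < r" for k
        using qe[OF that] by (simp add: ip_commute[of d q])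
      ultimately show "ip d (e' i) (e' j) = (if i = j then 1 else 0)"
        using e qe c
        by (cases "i = r"; cases "j = r")
          (simp_all add: orthonormal_def e'_def ip_scale_left ip_scale_right)
    qed
    moreover have "ip d (v i) u = 0" if "\<And>m. m < Suc r \<Longrightarrow> ip d (e' m) u = 0" "i < Suc n" for u i
    proof -
      have *: "ip d (e m) u = 0" if "m < r" for m
        using that \<open>\<And>m. m < Suc r \<Longrightarrow> ip d (e' m) u = 0\<close>[of m] by (simp add: e'_def)
      have "ip d q u = 0"
        using that(1)[of r] c by (simp add: e'_def ip_scale_left)
      with that * perp[of u i] vq[of u] show ?thesis
        by (cases "i = n") auto
    qed
    ultimately show ?thesis
      using r by (intro exI[of _ "Suc r"] exI[of _ e']) auto
  qed
qed

text \<open>The form is that of the orthogonal projection onto the span of \<open>e\<close>, whose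
  matrix has trace and squared Frobenius norm both equal to the rank \<open>r\<close>.\<close>

lemma second_moment_proj_dev:
  assumes "orthonormal d r e"
  shows "measure_pmf.expectation (cube_pmf d) (\<lambda>x. ((\<Sum>m<r. (ip d (e m) x)\<^sup>2) - 45/64 * real r)\<^sup>2)
       \<le> 50 * (9/64)\<^sup>2 * real r"
proof -
  define A where "A i j = (\<Sum>m<r. e m i * e m j)" for i j
  have tr: "(\<Sum>i<d. A i i) = real r"
  proof -
    have "(\<Sum>i<d. A i i) = (\<Sum>m<r. ip d (e m) (e m))"
      unfolding A_def ip_def by (rule sum.swap)
    also have "\<dots> = real r"
      using assms by (simp add: orthonormal_def)
    finally show ?thesis .
  qed
  have frob: "(\<Sum>i<d. \<Sum>j<d. (A i j)\<^sup>2) = real r"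
  proof -
    have "(\<Sum>i<d. \<Sum>j<d. (A i j)\<^sup>2)
        = (\<Sum>i<d. \<Sum>j<d. \<Sum>m<r. \<Sum>k<r. (e m i * e k i) * (e m j * e k j))"
      by (simp add: A_def power2_eq_square sum_product mult_ac)
    also have "\<dots> = (\<Sum>i<d. \<Sum>m<r. \<Sum>j<d. \<Sum>k<r. (e m i * e k i) * (e m j * e k j))"
      by (intro sum.cong refl sum.swap)
    also have "\<dots> = (\<Sum>m<r. \<Sum>i<d. \<Sum>j<d. \<Sum>k<r. (e m i * e k i) * (e m j * e k j))"
      by (rule sum.swap)
    also have "\<dots> = (\<Sum>m<r. \<Sum>i<d. \<Sum>k<r. \<Sum>j<d. (e m i * e k i) * (e m j * e k j))"
      by (intro sum.cong refl sum.swap)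
    also have "\<dots> = (\<Sum>m<r. \<Sum>k<r. \<Sum>i<d. \<Sum>j<d. (e m i * e k i) * (e m j * e k j))"
      by (intro sum.cong refl sum.swap)
    also have "\<dots> = (\<Sum>m<r. \<Sum>k<r. (ip d (e m) (e k))\<^sup>2)"
      by (simp add: ip_def power2_eq_square sum_product)
    also have "\<dots> = (\<Sum>m<r. \<Sum>k<r. if m = k then 1 else 0)"
      using assms by (intro sum.cong) (auto simp: orthonormal_def)
    also have "\<dots> = real r"
      by simp
    finally show ?thesis .
  qed
  have "quad_dev d A x = (\<Sum>m<r. (ip d (e m) x)\<^sup>2) - 45/64 * real r" for x
  proof -
    have "(\<Sum>i<d. \<Sum>j<d. A i j * x i * x j) = (\<Sum>i<d. \<Sum>j<d. \<Sum>m<r. (e m i * x i) * (e m j * x j))"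
      by (simp add: A_def sum_distrib_right sum_distrib_left mult_ac)
    also have "\<dots> = (\<Sum>i<d. \<Sum>m<r. \<Sum>j<d. (e m i * x i) * (e m j * x j))"
      by (intro sum.cong refl sum.swap)
    also have "\<dots> = (\<Sum>m<r. \<Sum>i<d. \<Sum>j<d. (e m i * x i) * (e m j * x j))"
      by (rule sum.swap)
    also have "\<dots> = (\<Sum>m<r. (ip d (e m) x)\<^sup>2)"
      by (simp add: ip_def power2_eq_square sum_product)
    finally show ?thesis
      by (simp add: quad_dev_def tr)
  qed
  moreover have "A i j = A j i" for i j
    by (simp add: A_def mult.commute)
  ultimately show ?thesis
    using second_moment_quad_dev[of A d] frob by simp
qed

text \<open>It bounds the squared norm of a sample point below by \<open>9/64 * d\<close> with
  certainty, so that only the projection onto earlier points needs a probabilistic estimate.\<close>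

lemma set_cube_pmf_sq_ge:
  assumes "x \<in> set_pmf (cube_pmf d)" "i < d"
  shows "9/64 \<le> (x i)\<^sup>2"
proof -
  have "\<forall>y\<in>set_pmf coord_pmf. 9/64 \<le> y\<^sup>2"
    by (simp add: set_coord_pmf power2_eq_square)
  moreover have "x i \<in> set_pmf coord_pmf"
    using assms by (simp add: cube_pmf_def set_Pi_pmf PiE_dflt_def)
  ultimately show ?thesis
    by blast
qed

section \<open>Least squared norm of an interpolant\<close>

text \<open>Coordinate 0 alone determines the sign label; \<open>u 0 = 0\<close> keeps it free for a
  later entry of the wrong sign.\<close>

definition interpolants :: "nat \<Rightarrow> (point \<Rightarrow> real) \<Rightarrow> nat \<Rightarrow> (nat \<Rightarrow> point) \<Rightarrow> point set" where
  "interpolants d \<tau> n S = {u. u 0 = 0 \<and> (\<forall>i<n. ip d u (S i) = \<tau> (S i))}"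

text \<open>Inserting \<open>1\<close> truncates the cost and avoids the junk value of the infimum when there is no interpolant.\<close>

definition interp_cost :: "nat \<Rightarrow> (point \<Rightarrow> real) \<Rightarrow> nat \<Rightarrow> (nat \<Rightarrow> point) \<Rightarrow> real" where
  "interp_cost d \<tau> n S = Inf (insert 1 ((\<lambda>u. 80 * ip d u u) ` interpolants d \<tau> n S))"

lemma bdd_below_interp: "bdd_below (insert 1 ((\<lambda>u. 80 * ip d u u) ` interpolants d \<tau> n S))"
  by (auto intro!: bdd_belowI[of _ 0])

lemma interp_cost_le_1: "interp_cost d \<tau> n S \<le> 1"
  unfolding interp_cost_def by (rule cInf_lower[OF _ bdd_below_interp]) simp

lemma interp_cost_nonneg: "0 \<le> interp_cost d \<tau> n S"
  unfolding interp_cost_def by (rule cInf_greatest) auto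

lemma interp_cost_le: "u \<in> interpolants d \<tau> n S \<Longrightarrow> interp_cost d \<tau> n S \<le> 80 * ip d u u"
  unfolding interp_cost_def by (rule cInf_lower[OF _ bdd_below_interp]) simp

text \<open>Since \<open>y \<le> 1\<close>, the inserted value 1 is not below \<open>y\<close>, so a
  genuine interpolant must be.\<close>

lemma interp_cost_less:
  assumes "interp_cost d \<tau> n S < y" "y \<le> 1"
  shows "\<exists>u\<in>interpolants d \<tau> n S. 80 * ip d u u < y"
proof -
  obtain z where "z \<in> insert 1 ((\<lambda>u. 80 * ip d u u) ` interpolants d \<tau> n S)" "z < y"
    using cInf_lessD[of "insert 1 ((\<lambda>u. 80 * ip d u u) ` interpolants d \<tau> n S)" y] assms
    by (auto simp: interp_cost_def)
  then show ?thesis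
    using assms by auto
qed

text \<open>The middle summand exceeds \<open>1\<close> when the new point lies too close to the span of the
  basis \<open>e\<close>; the last one bounds the increase of the squared norm otherwise.\<close>

lemma interp_cost_step_pointwise:
  assumes e: "orthonormal d r e" and r: "20 * r \<le> d" and d: "0 < d"
    and perp0: "\<And>u. (\<And>m. m < r \<Longrightarrow> ip d (e m) u = 0) \<Longrightarrow> u 0 = 0"
    and perp: "\<And>u i. (\<And>m. m < r \<Longrightarrow> ip d (e m) u = 0) \<Longrightarrow> i < n \<Longrightarrow> ip d (S i) u = 0"
    and u: "u \<in> interpolants d \<tau> n S"
    and u_span: "\<And>v. (\<And>m. m < r \<Longrightarrow> ip d (e m) v = 0) \<Longrightarrow> ip d u v = 0"
    and x: "x \<in> set_pmf (cube_pmf d)" and \<tau>: "\<bar>\<tau> x\<bar> \<le> 2"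
  shows "interp_cost d \<tau> (Suc n) (S(n := x))
    \<le> 80 * ip d u u
      + 16 / ((9/64)\<^sup>2 * (real d)\<^sup>2) * ((\<Sum>m<r. (ip d (e m) x)\<^sup>2) - 45/64 * real r)\<^sup>2
      + 20480 / (9 * real d) * (4 + (ip d u x)\<^sup>2)"
    (is "_ \<le> _ + ?fail + ?inc")
proof -
  define F where "F = (\<Sum>m<r. (ip d (e m) x)\<^sup>2)"
  have fail_nonneg: "0 \<le> ?fail" by simp
  have inc_nonneg: "0 \<le> ?inc" by simp
  have rd: "45/64 * real r \<le> 9/64 * real d / 4"
    using r by simp
  show ?thesis
  \<comment> \<open>The threshold is half of the certain lower bound on the squared norm of
    \<open>x\<close>. By \<open>rd\<close> the mean of \<open>F\<close> is at most half the
    threshold, so exceeding it forces a deviation whose square is cancelled by the coefficient of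
    \<open>?fail\<close>.\<close>
  proof (cases "F > 9/64 * real d / 2")
    case True
    then have "9/64 * real d / 4 \<le> F - 45/64 * real r"
      using rd by linarith
    then have "(9/64 * real d / 4)\<^sup>2 \<le> (F - 45/64 * real r)\<^sup>2"
      by (intro power_mono) auto
    then have "1 \<le> ?fail"
      using d by (simp add: F_def power_mult_distrib power_divide field_simps)
    moreover have "0 \<le> 80 * ip d u u" by simp
    ultimately show ?thesis
      using interp_cost_le_1[of d \<tau> "Suc n" "S(n := x)"] inc_nonneg by linarith
  next
    case False
    define q where "q = resid d r e x"
    have qe: "ip d (e m) q = 0" if "m < r" for m
      using resid_perp[OF e that] by (simp add: q_def)
    have "(\<Sum>i<d. 9/64) \<le> ip d x x"
      unfolding ip_self using set_cube_pmf_sq_ge[OF x] by (intro sum_mono) auto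
    then have qq: "9/64 * real d / 2 \<le> ip d q q"
      using False by (simp add: q_def ip_resid_self[OF e] F_def)
    have qpos: "0 < ip d q q"
      using qq d by (intro less_le_trans[OF _ qq]) simp
    have qx: "ip d q x = ip d q q"
      using ip_resid_perp[of r d e q x] qe by (simp add: q_def[symmetric] ip_commute)
    \<comment> \<open>As \<open>q\<close> is orthogonal to the earlier points, adding a multiple of
      it preserves their constraints; \<open>qx\<close> makes this \<open>c\<close> meet the new
      one.\<close>
    define c where "c = (\<tau> x - ip d u x) / ip d q q"
    define u' where "u' = (\<lambda>i. u i + c * q i)"
    have ip': "ip d u' v = ip d u v + c * ip d q v" for v
      by (simp add: u'_def ip_add_left ip_scale_left)
    \<comment> \<open>Hence the correction is orthogonal to \<open>u\<close>, and squared norms add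
      up.\<close>
    have uq: "ip d u q = 0"
      using u_span qe by blast
    have "u' \<in> interpolants d \<tau> (Suc n) (S(n := x))"
    proof -
      have "u' 0 = 0"
        using u perp0[of q] qe by (simp add: u'_def interpolants_def)
      moreover have "ip d u' (S i) = \<tau> (S i)" if "i < n" for i
        using u perp[of q i] qe that by (simp add: ip' interpolants_def ip_commute[of d q])
      moreover have "ip d u' x = \<tau> x"
        using qpos by (simp add: ip' qx c_def)
      ultimately show ?thesis
        by (auto simp: interpolants_def less_Suc_eq)
    qed
    then have cost: "interp_cost d \<tau> (Suc n) (S(n := x)) \<le> 80 * ip d u' u'"
      by (rule interp_cost_le)
    have "ip d u' u' = ip d u u + (\<tau> x - ip d u x)\<^sup>2 / ip d q q"
    proof -
      have "ip d q u = 0"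
        using uq by (simp only: ip_commute[of d q u])
      then have "ip d u u' = ip d u u"
        by (simp add: ip_commute[of d u u'] ip')
      moreover have "ip d q u' = c * ip d q q"
        using uq by (simp add: ip_commute[of d q u'] ip')
      ultimately have "ip d u' u' = ip d u u + c * (c * ip d q q)"
        by (simp only: ip'[of u'])
      also have "c * (c * ip d q q) = (\<tau> x - ip d u x)\<^sup>2 / ip d q q"
        using qpos by (simp add: c_def power2_eq_square)
      finally show ?thesis .
    qed
    moreover have "(\<tau> x - ip d u x)\<^sup>2 / ip d q q \<le> (2 * (4 + (ip d u x)\<^sup>2)) / (9/64 * real d / 2)"
    proof (rule frac_le)
      have "(\<tau> x)\<^sup>2 \<le> 4"
        using power_mono[OF \<tau>, of 2] by simp
      moreover have "0 \<le> (\<tau> x + ip d u x)\<^sup>2"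
        by simp
      ultimately show "(\<tau> x - ip d u x)\<^sup>2 \<le> 2 * (4 + (ip d u x)\<^sup>2)"
        by (simp add: power2_eq_square algebra_simps)
    qed (use qq d in auto)
    moreover have "80 * (2 * (4 + (ip d u x)\<^sup>2) / (9/64 * real d / 2)) = ?inc"
      using d by (simp add: field_simps)
    ultimately show ?thesis
      using cost fail_nonneg by linarith
  qed
qed

text \<open>A nearly optimal interpolant, projected to the span of the sample and the first unit
  vector, is fed into the pointwise bound, which is then averaged over the new point. The slack
  \<open>\<eta>\<close> avoids showing that the infimum is attained.\<close>

lemma interp_cost_step:
  assumes n: "20 * Suc n \<le> d" and \<tau>: "\<And>x. \<bar>\<tau> x\<bar> \<le> 2"
  shows "measure_pmf.expectation (cube_pmf d) (\<lambda>x. interp_cost d \<tau> (Suc n) (S(n := x)))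
    \<le> interp_cost d \<tau> n S + 10000 / real d"
    (is "?E \<le> _")
proof (rule field_le_epsilon)
  fix \<eta> :: real
  assume \<eta>: "0 < \<eta>"
  have d: "0 < d" using n by (cases d) auto
  have E1: "?E \<le> 1"
    using integral_mono[of "cube_pmf d" "\<lambda>x. interp_cost d \<tau> (Suc n) (S(n := x))" "\<lambda>_. 1"]
    by (simp add: interp_cost_le_1)
  show "?E \<le> interp_cost d \<tau> n S + 10000 / real d + \<eta>"
  proof (cases "1 \<le> interp_cost d \<tau> n S + \<eta>")
    case True
    moreover have "0 \<le> 10000 / real d" by simp
    ultimately show ?thesis using E1 by linarith
  next
    case False
    then obtain u0 where u0: "u0 \<in> interpolants d \<tau> n S" "80 * ip d u0 u0 < interp_cost d \<tau> n S + \<eta>"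
      using interp_cost_less[of d \<tau> n S "interp_cost d \<tau> n S + \<eta>"] \<eta> by auto
    \<comment> \<open>The first unit vector joins the \<open>n\<close> sample points, so that
      corrections leave coordinate 0 at zero; this is why up to \<open>Suc n\<close> basis vectors
      occur.\<close>
    define v where "v = S(n := (\<lambda>i. if i = 0 then 1 else 0 :: real))"
    obtain r e where r: "r \<le> Suc n" and e: "orthonormal d r e"
      and perpv: "\<And>u i. (\<And>m. m < r \<Longrightarrow> ip d (e m) u = 0) \<Longrightarrow> i < Suc n \<Longrightarrow> ip d (v i) u = 0"
      using gram_schmidt[of "Suc n" d v] by blast
    have perp0: "u 0 = 0" if "\<And>m. m < r \<Longrightarrow> ip d (e m) u = 0" for u
    proof -
      have "ip d (\<lambda>i. if i = 0 then 1 else 0) u = 0"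
        using perpv[OF that, of n] by (simp add: v_def)
      moreover have "ip d (\<lambda>i. if i = 0 then 1 else 0) u = (\<Sum>i<d. if i = 0 then u i else 0)"
        unfolding ip_def by (intro sum.cong) auto
      ultimately show ?thesis
        using d by simp
    qed
    have perp: "ip d (S i) u = 0" if "\<And>m. m < r \<Longrightarrow> ip d (e m) u = 0" "i < n" for u i
      using perpv[OF that(1), of i] that(2) by (simp add: v_def)
    \<comment> \<open>Projecting \<open>u0\<close> to the span of \<open>e\<close> keeps it an interpolant and makes it orthogonal to the next correction.\<close>
    define w where "w = resid d r e u0"
    have we: "ip d (e m) w = 0" if "m < r" for m
      using resid_perp[OF e that] by (simp add: w_def)
    define u where "u = (\<lambda>i. u0 i - w i)"
    have u: "u \<in> interpolants d \<tau> n S"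
      using u0(1) perp0[OF we] perp[OF we]
      by (auto simp: interpolants_def u_def ip_diff_left ip_commute[of d w])
    have u_span: "ip d u q = 0" if "\<And>m. m < r \<Longrightarrow> ip d (e m) q = 0" for q
      using ip_resid_perp[of r d e q u0, OF that] by (simp add: u_def w_def ip_diff_left)
    have "ip d u u = ip d u0 u0 - ip d w w"
      using u_span[OF we] ip_resid_perp[of r d e w u0] we
      by (simp add: u_def ip_diff_left ip_diff_right ip_commute[of d w u0] w_def[symmetric])
    then have uu: "80 * ip d u u < interp_cost d \<tau> n S + \<eta>"
      using u0(2) ip_self_nonneg[of d w] by linarith
    have r20: "20 * r \<le> d"
      by (rule order_trans[OF mult_le_mono2[OF r] n])
    let ?F = "\<lambda>x. ((\<Sum>m<r. (ip d (e m) x)\<^sup>2) - 45/64 * real r)\<^sup>2"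
    let ?bound = "\<lambda>x. 80 * ip d u u + 16 / ((9/64)\<^sup>2 * (real d)\<^sup>2) * ?F x
        + 20480 / (9 * real d) * (4 + (ip d u x)\<^sup>2)"
    have "?E \<le> measure_pmf.expectation (cube_pmf d) ?bound"
    proof (intro integral_mono_AE integrable_cube_pmf AE_pmfI)
      fix x
      assume x: "x \<in> set_pmf (cube_pmf d)"
      show "interp_cost d \<tau> (Suc n) (S(n := x)) \<le> ?bound x"
        by (rule interp_cost_step_pointwise) (fact e r20 d perp0 perp u u_span x \<tau>)+
    qed
    also have "\<dots> = 80 * ip d u u
        + 16 / ((9/64)\<^sup>2 * (real d)\<^sup>2) * measure_pmf.expectation (cube_pmf d) ?F
        + 20480 / (9 * real d) * (4 + 45/64 * ip d u u)"
      by (simp add: second_moment_ip ip_self[symmetric])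
    also have "\<dots> \<le> 80 * ip d u u
        + 16 / ((9/64)\<^sup>2 * (real d)\<^sup>2) * (50 * (9/64)\<^sup>2 * real r)
        + 20480 / (9 * real d) * (4 + 45/64 * (1/80))"
    proof -
      have "16 / ((9/64)\<^sup>2 * (real d)\<^sup>2) * measure_pmf.expectation (cube_pmf d) ?F
        \<le> 16 / ((9/64)\<^sup>2 * (real d)\<^sup>2) * (50 * (9/64)\<^sup>2 * real r)"
        by (intro mult_left_mono second_moment_proj_dev e) simp
      moreover have "20480 / (9 * real d) * (4 + 45/64 * ip d u u)
        \<le> 20480 / (9 * real d) * (4 + 45/64 * (1/80))"
        using uu False by (intro mult_left_mono add_left_mono) auto
      ultimately show ?thesis by linarith
    qed
    \<comment> \<open>The failure term is \<open>800 * r / d^2\<close>, at most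
      \<open>40 / d\<close> by \<open>20 * r \<le> d\<close>; the increase term is below
      \<open>9900 / d\<close>. The constant \<open>10000\<close> is rounded up.\<close>
    also have "\<dots> \<le> 80 * ip d u u + 10000 / real d"
    proof -
      have "16 / ((9/64)\<^sup>2 * (real d)\<^sup>2) * (50 * (9/64)\<^sup>2 * real r) = 800 * real r / (real d * real d)"
        by (simp add: power2_eq_square)
      also have "\<dots> \<le> 40 / real d"
        using d r20 by (simp add: divide_simps)
      finally have "16 / ((9/64)\<^sup>2 * (real d)\<^sup>2) * (50 * (9/64)\<^sup>2 * real r) \<le> 40 / real d" .
      moreover have "20480 / (9 * real d) * (4 + 45/64 * (1/80)) \<le> 9900 / real d"
        using d by (simp add: divide_simps)
      moreover have "40 / real d + 9900 / real d \<le> 10000 / real d"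
        using d by (simp add: divide_simps)
      ultimately show ?thesis by linarith
    qed
    also have "\<dots> \<le> interp_cost d \<tau> n S + 10000 / real d + \<eta>"
      using uu by simp
    finally show ?thesis .
  qed
qed

definition sample_pmf :: "nat \<Rightarrow> nat \<Rightarrow> (nat \<Rightarrow> point) pmf" where
  "sample_pmf d n = Pi_pmf {..<n} undefined (\<lambda>_. cube_pmf d)"

lemma integrable_sample_pmf [simp]:
  "integrable (measure_pmf (sample_pmf d n)) (f :: (nat \<Rightarrow> point) \<Rightarrow> real)"
  by (rule integrable_measure_pmf_finite) (simp add: sample_pmf_def finite_set_Pi_pmf)

text \<open>The last point is independent of the earlier ones, so it can be averaged first with them
  held fixed, and the one-step increases add up.\<close>

lemma expectation_interp_cost:
  assumes "20 * n \<le> d" and \<tau>: "\<And>x. \<bar>\<tau> x\<bar> \<le> 2"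
  shows "measure_pmf.expectation (sample_pmf d n) (interp_cost d \<tau> n) \<le> 10000 * real n / real d"
  using assms(1)
proof (induction n)
  case 0
  have "interp_cost d \<tau> 0 S \<le> 0" for S
    using interp_cost_le[of "\<lambda>_. 0" d \<tau> 0 S] by (simp add: interpolants_def ip_def)
  then have "measure_pmf.expectation (sample_pmf d 0) (interp_cost d \<tau> 0) \<le> measure_pmf.expectation (sample_pmf d 0) (\<lambda>_. 0)"
    by (intro integral_mono) auto
  then show ?case by simp
next
  case (Suc n)
  have "measure_pmf.expectation (sample_pmf d (Suc n)) (interp_cost d \<tau> (Suc n))
      = measure_pmf.expectation (sample_pmf d n)
          (\<lambda>S. measure_pmf.expectation (cube_pmf d) (\<lambda>x. interp_cost d \<tau> (Suc n) (S(n := x))))"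
    unfolding sample_pmf_def lessThan_Suc by (rule expectation_Pi_pmf_insert) auto
  also have "\<dots> \<le> measure_pmf.expectation (sample_pmf d n) (\<lambda>S. interp_cost d \<tau> n S + 10000 / real d)"
    by (intro integral_mono interp_cost_step Suc.prems \<tau>) auto
  also have "\<dots> \<le> 10000 * real (Suc n) / real d"
    using Suc by (simp add: add_divide_distrib distrib_left)
  finally show ?case .
qed

text \<open>Markov's inequality; the factor \<open>20000\<close> brings the expected cost down to at
  most \<open>1/2\<close>.\<close>

lemma prob_interp_cost_less_1:
  assumes "20000 * n \<le> d" "0 < d" and \<tau>: "\<And>x. \<bar>\<tau> x\<bar> \<le> 2"
  shows "1/2 \<le> measure_pmf.prob (sample_pmf d n) {S. interp_cost d \<tau> n S < 1}"
proof -
  have "1 - measure_pmf.prob (sample_pmf d n) {S. interp_cost d \<tau> n S < 1}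
      = measure_pmf.prob (sample_pmf d n) (UNIV - {S. interp_cost d \<tau> n S < 1})"
    using measure_pmf.prob_compl[of "{S. interp_cost d \<tau> n S < 1}" "sample_pmf d n"] by simp
  also have "UNIV - {S. interp_cost d \<tau> n S < 1} = {S. 1 \<le> interp_cost d \<tau> n S}"
    by auto
  also have "measure_pmf.prob (sample_pmf d n) {S. 1 \<le> interp_cost d \<tau> n S}
      \<le> measure_pmf.expectation (sample_pmf d n) (interp_cost d \<tau> n) / 1"
    using integral_Markov_inequality_measure[of "sample_pmf d n" "interp_cost d \<tau> n" "{}" 1]
    by (simp add: interp_cost_nonneg)
  also have "\<dots> \<le> 10000 * real n / real d"
    using expectation_interp_cost[OF _ \<tau>, where n=n and d=d] assms(1) by simp
  also have "\<dots> \<le> 1/2"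
    using assms by (simp add: divide_simps)
  finally show ?thesis by simp
qed

section \<open>Labelled distributions\<close>

text \<open>Restricting the points and reading the labels from a boolean makes the map land in the space of
  \<open>Zd d\<close> everywhere, not just on the support of \<open>p\<close>.\<close>

definition labelled :: "nat \<Rightarrow> 'a pmf \<Rightarrow> ('a \<Rightarrow> point) \<Rightarrow> ('a \<Rightarrow> bool) \<Rightarrow> example measure" where
  "labelled d p X B = distr (measure_pmf p) (Zd d) (\<lambda>a. (restrict (X a) {..<d}, if B a then 1 else - 1))"

lemma space_Zd: "space (Zd d) = PiE {..<d} (\<lambda>_. UNIV) \<times> {- 1, 1}"
  by (simp add: Zd_def space_pair_measure space_PiM)

lemma restrict_in_space_Zd [simp]: "(restrict x {..<d}, y) \<in> space (Zd d) \<longleftrightarrow> y \<in> {- 1, 1}"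
  by (simp add: space_Zd)

lemma measurable_labelled [measurable]:
  "(\<lambda>a. (restrict (X a) {..<d}, if B a then 1 else - 1)) \<in> measure_pmf p \<rightarrow>\<^sub>M Zd d"
  by simp

lemma sets_labelled [simp, measurable_cong]: "sets (labelled d p X B) = sets (Zd d)"
  by (simp add: labelled_def)

lemma space_labelled [simp]: "space (labelled d p X B) = space (Zd d)"
  by (simp add: labelled_def)

lemma prob_space_labelled: "prob_space (labelled d p X B)"
  unfolding labelled_def by (rule measure_pmf.prob_space_distr) simp

lemma is_distr_labelled: "is_distr d (labelled d p X B)"
  by (simp add: is_distr_def prob_space_labelled)

lemma measurable_coord_Zd: "i < d \<Longrightarrow> (\<lambda>z. fst z i) \<in> borel_measurable (Zd d)"
  unfolding Zd_def by measurable

lemma measurable_ip_Zd [measurable]: "(\<lambda>z. ip d w (fst z)) \<in> borel_measurable (Zd d)"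
  unfolding ip_def by (intro borel_measurable_sum borel_measurable_times measurable_coord_Zd) auto

lemma measurable_snd_Zd [measurable]: "snd \<in> borel_measurable (Zd d)"
  unfolding Zd_def by (rule measurable_compose[OF measurable_snd]) simp

lemma ip_restrict [simp]: "ip d w (restrict x {..<d}) = ip d w x"
  by (simp add: ip_def)

lemma measure_labelled:
  assumes "{z \<in> space (Zd d). R z} \<in> sets (Zd d)"
  shows "measure (labelled d p X B) {z \<in> space (Zd d). R z}
       = measure_pmf.prob p {a. R (restrict (X a) {..<d}, if B a then 1 else - 1)}"
proof -
  have "measure (labelled d p X B) {z \<in> space (Zd d). R z}
      = measure_pmf.prob p ((\<lambda>a. (restrict (X a) {..<d}, if B a then 1 else - 1)) -`
          {z \<in> space (Zd d). R z} \<inter> space (measure_pmf p))"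
    unfolding labelled_def by (rule measure_distr) (use assms in auto)
  also have "\<dots> = measure_pmf.prob p {a. R (restrict (X a) {..<d}, if B a then 1 else - 1)}"
    by (intro arg_cong[where f="measure_pmf.prob p"]) auto
  finally show ?thesis .
qed

lemma loss_labelled:
  "loss \<gamma> (\<lambda>x. ip d w x) (labelled d p X B)
     = measure_pmf.prob p {a. (if B a then 1 else - 1) * ip d w (X a) \<le> \<gamma>}"
proof -
  have "loss \<gamma> (\<lambda>x. ip d w x) (labelled d p X B)
    = measure_pmf.prob p {a. snd (restrict (X a) {..<d}, if B a then 1 else - 1 :: real)
        * ip d w (fst (restrict (X a) {..<d}, if B a then 1 else - 1 :: real)) \<le> \<gamma>}"
    unfolding loss_def space_labelled by (rule measure_labelled) measurable
  then show ?thesis by simp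
qed

lemma integral_labelled:
  fixes g :: "point \<Rightarrow> real"
  assumes "(\<lambda>z. g (fst z)) \<in> borel_measurable (Zd d)"
  shows "(\<integral>z. g (fst z) \<partial>labelled d p X B) = measure_pmf.expectation p (\<lambda>a. g (restrict (X a) {..<d}))"
  unfolding labelled_def by (subst integral_distr[OF measurable_labelled assms]) simp

text \<open>Only the image of \<open>p\<close> under \<open>X\<close> enters, so distributions that
  differ in their labels alone have the same covariances.\<close>

lemma cov_X_labelled:
  assumes "map_pmf X p = q" "i < d" "j < d"
  shows "cov_X (labelled d p X B) i j = measure_pmf.expectation q (\<lambda>x. x i * x j)
     - measure_pmf.expectation q (\<lambda>x. x i) * measure_pmf.expectation q (\<lambda>x. x j)"
  using assms(2,3) measurable_coord_Zd[of i d] measurable_coord_Zd[of j d]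
  by (simp add: cov_X_def integral_labelled[of "\<lambda>x. x i * x j"] integral_labelled[of "\<lambda>x. x i"]
      integral_labelled[of "\<lambda>x. x j"] assms(1)[symmetric])

section \<open>Sub-Gaussian bounds for the marginal\<close>

text \<open>Hoeffding's lemma for a fair sign times \<open>x\<close>: factoring out
  \<open>exp (- y)\<close> gives the expression bounded by \<open>Hoeffdings_lemma_aux\<close> for
  an interval of length \<open>2 * y\<close> and weight \<open>1/2\<close>. Evenness of
  \<open>cosh\<close> covers negative arguments.\<close>

lemma cosh_le_exp_half_sq: "cosh (x::real) \<le> exp (x\<^sup>2 / 2)"
proof -
  have pos: "cosh y \<le> exp (y\<^sup>2 / 2)" if "0 \<le> y" for y :: real
  proof -
    have c: "cosh y = exp (- y) * (1 + 1/2 * (exp (2 * y) - 1))"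
      by (simp add: cosh_field_def algebra_simps flip: exp_add)
    have "1 + 1/2 * (exp (2 * y) - 1) > 0"
      by (simp add: algebra_simps add_pos_pos)
    then have "ln (cosh y) = - (2 * y) * (1/2) + ln (1 + 1/2 * (exp (2 * y) - 1))"
      unfolding c by (subst ln_mult) auto
    also have "\<dots> \<le> (2 * y)\<^sup>2 / 8"
      using that by (intro Hoeffdings_lemma_aux) auto
    finally have "exp (ln (cosh y)) \<le> exp (y\<^sup>2 / 2)"
      unfolding exp_le_cancel_iff by (simp add: power_mult_distrib)
    then show ?thesis
      by simp
  qed
  show ?thesis
    using pos[of "\<bar>x\<bar>"] by simp
qed

text \<open>The outer atoms give the exponent \<open>81/128 * t^2\<close>, below
  \<open>90/128 * t^2\<close>. The latter is twice the variance times \<open>t^2 / 2\<close>, which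
  is what relative moment \<open>sqrt 2\<close> allows.\<close>

lemma exp_moment_coord_pmf:
  "measure_pmf.expectation coord_pmf (\<lambda>y. exp (t * y)) \<le> exp (45/64 * t\<^sup>2)"
proof -
  have "measure_pmf.expectation coord_pmf (\<lambda>y. exp (t * y)) = (cosh (9/8 * t) + cosh (3/8 * t)) / 2"
    by (simp add: expectation_coord_pmf cosh_def mult.commute field_simps)
  also have "cosh (9/8 * t) \<le> exp (45/64 * t\<^sup>2)"
    by (rule order_trans[OF cosh_le_exp_half_sq]) (simp add: power2_eq_square)
  also have "cosh (3/8 * t) \<le> exp (45/64 * t\<^sup>2)"
    by (rule order_trans[OF cosh_le_exp_half_sq]) (simp add: power2_eq_square)
  finally show ?thesis by simp
qed

lemma exp_moment_cube_pmf:
  "measure_pmf.expectation (cube_pmf d) (\<lambda>x. exp (t * ip d u x)) \<le> exp (t\<^sup>2 * (45/64 * (\<Sum>i<d. (u i)\<^sup>2)))"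
proof -
  have "measure_pmf.expectation (cube_pmf d) (\<lambda>x. exp (t * ip d u x))
      = measure_pmf.expectation (cube_pmf d) (\<lambda>x. \<Prod>i<d. exp (t * u i * x i))"
    by (simp add: ip_def sum_distrib_left exp_sum mult.assoc)
  also have "\<dots> = (\<Prod>i<d. measure_pmf.expectation coord_pmf (\<lambda>y. exp (t * u i * y)))"
    unfolding cube_pmf_def
    by (rule expectation_prod_Pi_pmf)
      (auto intro!: integrable_measure_pmf_finite simp: set_coord_pmf)
  also have "\<dots> \<le> (\<Prod>i<d. exp (45/64 * (t * u i)\<^sup>2))"
    by (intro prod_mono conjI exp_moment_coord_pmf integral_nonneg) auto
  also have "\<dots> = exp (\<Sum>i<d. 45/64 * (t * u i)\<^sup>2)"
    by (simp add: exp_sum)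
  also have "(\<Sum>i<d. 45/64 * (t * u i)\<^sup>2) = t\<^sup>2 * (45/64 * (\<Sum>i<d. (u i)\<^sup>2))"
    by (simp add: sum_distrib_left power_mult_distrib mult_ac)
  finally show ?thesis .
qed

lemma subgauss_rel_labelled:
  assumes "map_pmf X p = cube_pmf d" "finite (set_pmf p)"
  shows "subgauss_rel (labelled d p X B) (\<lambda>z. ip d u (fst z)) (sqrt 2)"
proof -
  have int: "integrable (measure_pmf p) (f :: 'a \<Rightarrow> real)" for f
    using assms(2) by (rule integrable_measure_pmf_finite)
  have E: "measure_pmf.expectation p (\<lambda>a. g (X a)) = measure_pmf.expectation (cube_pmf d) g" for g :: "point \<Rightarrow> real"
    by (simp add: assms(1)[symmetric])
  have m2: "(\<integral>z. (ip d u (fst z))\<^sup>2 \<partial>labelled d p X B) = 45/64 * (\<Sum>i<d. (u i)\<^sup>2)"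
    using E[of "\<lambda>x. (ip d u x)\<^sup>2"]
    by (simp add: integral_labelled[of "\<lambda>x. (ip d u x)\<^sup>2"] second_moment_ip)
  have "integrable (labelled d p X B) (\<lambda>z. (ip d u (fst z))\<^sup>2)"
    unfolding labelled_def by (subst integrable_distr_eq) (auto simp: int)
  moreover have "(\<integral>\<^sup>+ z. ennreal (exp (t * ip d u (fst z))) \<partial>labelled d p X B)
      \<le> ennreal (exp (t\<^sup>2 * (45/64 * (\<Sum>i<d. (u i)\<^sup>2))))" for t
  proof -
    have "(\<integral>\<^sup>+ z. ennreal (exp (t * ip d u (fst z))) \<partial>labelled d p X B)
        = (\<integral>\<^sup>+ a. ennreal (exp (t * ip d u (X a))) \<partial>measure_pmf p)"
      unfolding labelled_def by (subst nn_integral_distr) auto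
    also have "\<dots> = ennreal (measure_pmf.expectation p (\<lambda>a. exp (t * ip d u (X a))))"
      by (rule nn_integral_eq_integral) (auto simp: int)
    also have "\<dots> \<le> ennreal (exp (t\<^sup>2 * (45/64 * (\<Sum>i<d. (u i)\<^sup>2))))"
      using exp_moment_cube_pmf[of d t u] E[of "\<lambda>x. exp (t * ip d u x)"]
      by (intro ennreal_leI) (simp only:)
    finally show ?thesis .
  qed
  ultimately show ?thesis
    unfolding subgauss_rel_def m2 by (simp add: mult.left_commute)
qed

lemma emeasure_labelled:
  assumes "C \<in> sets (Zd d)"
  shows "emeasure (labelled d p X B) C
       = emeasure (measure_pmf p) ((\<lambda>a. (restrict (X a) {..<d}, if B a then 1 else - 1)) -` C)"
  unfolding labelled_def by (subst emeasure_distr[OF measurable_labelled assms]) (simp only: space_measure_pmf Int_UNIV_right)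

text \<open>It transfers sample events to a product pmf, where expectations are finite sums. Both
  measures agree on boxes, which determine a product measure.\<close>

lemma PiM_labelled:
  fixes n :: nat
  shows "PiM {..<n} (\<lambda>_. labelled d p X B)
   = distr (measure_pmf (Pi_pmf {..<n} dflt (\<lambda>_. p))) (PiM {..<n} (\<lambda>_. labelled d p X B))
       (\<lambda>S. \<lambda>i\<in>{..<n}. (restrict (X (S i)) {..<d}, if B (S i) then 1 else - 1))"
    (is "_ = distr ?M ?N ?g")
proof -
  have sf: "product_sigma_finite (\<lambda>_::nat. labelled d p X B)"
    by (simp add: product_sigma_finite_def prob_space_labelled prob_space_imp_sigma_finite)
  have g: "?g \<in> ?M \<rightarrow>\<^sub>M ?N"
    by (auto simp: space_PiM)
  show ?thesis
  proof (rule product_sigma_finite.PiM_eqI[OF sf, symmetric])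
    fix A assume A: "\<And>i. i \<in> {..<n} \<Longrightarrow> A i \<in> sets (labelled d p X B)"
    let ?e = "\<lambda>a. (restrict (X a) {..<d}, if B a then 1 else - 1 :: real)"
    have "emeasure (distr ?M ?N ?g) (Pi\<^sub>E {..<n} A) = emeasure ?M (?g -` (Pi\<^sub>E {..<n} A) \<inter> space ?M)"
      by (rule emeasure_distr[OF g]) (rule sets_PiM_I_finite, simp, rule A)
    also have "?g -` (Pi\<^sub>E {..<n} A) \<inter> space ?M = Pi {..<n} (\<lambda>i. ?e -` A i)"
      by (intro set_eqI) (simp add: PiE_iff Pi_iff split del: if_split)
    also have "emeasure ?M \<dots> = ennreal (measure ?M (Pi {..<n} (\<lambda>i. ?e -` A i)))"
      by (rule measure_pmf.emeasure_eq_measure)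
    also have "\<dots> = ennreal (\<Prod>i<n. measure_pmf.prob p (?e -` A i))"
      by (subst measure_Pi_pmf_Pi) simp_all
    also have "\<dots> = (\<Prod>i<n. ennreal (measure_pmf.prob p (?e -` A i)))"
      by (rule prod_ennreal[symmetric]) simp
    also have "\<dots> = (\<Prod>i<n. emeasure (labelled d p X B) (A i))"
    proof (rule prod.cong[OF refl])
      fix i assume "i \<in> {..<n}"
      then have "A i \<in> sets (Zd d)"
        using A by simp
      then show "ennreal (measure_pmf.prob p (?e -` A i)) = emeasure (labelled d p X B) (A i)"
        by (simp only: emeasure_labelled measure_pmf.emeasure_eq_measure)
    qed
    finally show "emeasure (distr ?M ?N ?g) (Pi\<^sub>E {..<n} A) = (\<Prod>i<n. emeasure (labelled d p X B) (A i))" .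
  qed simp_all
qed

section \<open>Upper bound for random labels\<close>

text \<open>With all coordinates except \<open>i\<close> fixed, at most one value of coordinate
  \<open>i\<close> solves the equation, and no atom of \<open>coord_pmf\<close> exceeds
  \<open>1/4\<close>.\<close>

lemma prob_ip_eq_0:
  assumes i: "i < d" and w: "w i \<noteq> 0"
  shows "measure_pmf.prob (cube_pmf d) {x. ip d w x = 0} \<le> 1/4"
proof -
  let ?I = "indicator {x. ip d w x = 0} :: point \<Rightarrow> real"
  have ins: "{..<d} = insert i ({..<d} - {i})"
    using i by auto
  have upd: "ip d w (x(i := y)) = ip d w (x(i := 0)) + w i * y" for x y
  proof -
    have "ip d w (x(i := z)) = w i * z + (\<Sum>j\<in>{..<d} - {i}. w j * x j)" for z
      unfolding ip_def by (subst sum.remove[of _ i]) (use i in \<open>auto intro!: sum.cong\<close>)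
    from this[of y] this[of 0] show ?thesis by simp
  qed
  have slice: "measure_pmf.expectation coord_pmf (\<lambda>y. ?I (x(i := y))) \<le> 1/4" for x
  proof -
    have "ip d w (x(i := y)) = 0 \<longleftrightarrow> y = - ip d w (x(i := 0)) / w i" for y
      unfolding upd[of x y] using w by (auto simp: field_simps)
    then show ?thesis
      unfolding expectation_coord_pmf by (auto simp: indicator_def)
  qed
  have "measure_pmf.prob (cube_pmf d) {x. ip d w x = 0} = measure_pmf.expectation (cube_pmf d) ?I"
    by simp
  also have "\<dots> = measure_pmf.expectation (Pi_pmf ({..<d} - {i}) 0 (\<lambda>_. coord_pmf))
      (\<lambda>x. measure_pmf.expectation coord_pmf (\<lambda>y. ?I (x(i := y))))"
    unfolding cube_pmf_def
    by (subst ins, rule expectation_Pi_pmf_insert) (auto simp: set_coord_pmf)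
  also have "\<dots> \<le> measure_pmf.expectation (Pi_pmf ({..<d} - {i}) 0 (\<lambda>_. coord_pmf)) (\<lambda>_. 1/4)"
    by (intro integral_mono slice integrable_measure_pmf_finite finite_set_Pi_pmf)
      (auto simp: set_coord_pmf)
  finally show ?thesis
    by simp
qed

lemma prob_abs_ip_gt:
  assumes "0 < c"
  shows "measure_pmf.prob (cube_pmf d) {x. c < \<bar>ip d w x\<bar>} \<le> 45/64 * (\<Sum>i<d. (w i)\<^sup>2) / c\<^sup>2"
proof -
  have "measure_pmf.prob (cube_pmf d) {x. c < \<bar>ip d w x\<bar>}
      \<le> measure_pmf.prob (cube_pmf d) {x. c\<^sup>2 \<le> (ip d w x)\<^sup>2}"
  proof (rule measure_pmf.finite_measure_mono)
    show "{x. c < \<bar>ip d w x\<bar>} \<subseteq> {x. c\<^sup>2 \<le> (ip d w x)\<^sup>2}"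
      using assms by (auto simp: abs_le_square_iff[symmetric])
  qed simp
  also have "\<dots> \<le> measure_pmf.expectation (cube_pmf d) (\<lambda>x. (ip d w x)\<^sup>2) / c\<^sup>2"
    using integral_Markov_inequality_measure[of "cube_pmf d" "\<lambda>x. (ip d w x)\<^sup>2" "{}" "c\<^sup>2"] assms
    by simp
  finally show ?thesis
    by (simp add: second_moment_ip)
qed

lemma prob_abs_first_coord_le_1:
  assumes "0 < d"
  shows "measure_pmf.prob (cube_pmf d) {x. \<bar>x 0\<bar> \<le> 1} = 1/2"
proof -
  have "measure_pmf.prob (cube_pmf d) {x. \<bar>x 0\<bar> \<le> 1}
      = measure_pmf.prob (map_pmf (\<lambda>x. x 0) (cube_pmf d)) {y. \<bar>y\<bar> \<le> 1}"
    by (simp add: measure_map_pmf vimage_def)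
  also have "map_pmf (\<lambda>x. x 0) (cube_pmf d) = coord_pmf"
    using assms by (simp add: cube_pmf_def Pi_pmf_component)
  also have "measure_pmf.prob coord_pmf {y. \<bar>y\<bar> \<le> 1}
      = measure_pmf.expectation coord_pmf (indicator {y. \<bar>y\<bar> \<le> 1})"
    by simp
  also have "\<dots> = 1/2"
    unfolding expectation_coord_pmf by (simp add: indicator_def)
  finally show ?thesis .
qed

section \<open>The two labelled distributions\<close>

definition noise_pmf :: "nat \<Rightarrow> (point \<times> bool) pmf" where
  "noise_pmf d = pair_pmf (cube_pmf d) (bernoulli_pmf (1/2))"

definition noise_distr :: "nat \<Rightarrow> example measure" where
  "noise_distr d = labelled d (noise_pmf d) fst snd"

text \<open>For \<open>0 < d\<close> the tie \<open>x 0 = 0\<close> lies outside the support, so its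
  label does not matter.\<close>

definition sign_distr :: "nat \<Rightarrow> example measure" where
  "sign_distr d = labelled d (cube_pmf d) (\<lambda>x. x) (\<lambda>x. 0 \<le> x 0)"

lemma map_fst_noise_pmf: "map_pmf fst (noise_pmf d) = cube_pmf d"
  by (simp add: noise_pmf_def map_fst_pair_pmf)

lemma finite_set_noise_pmf: "finite (set_pmf (noise_pmf d))"
  by (simp add: noise_pmf_def)

text \<open>A fair label averages the events \<open>ip d w x \<le> \<gamma>\<close> and
  \<open>- ip d w x \<le> \<gamma>\<close>; the probability of \<open>ip d w x < - \<gamma>\<close>
  cancels.\<close>

lemma loss_noise_distr:
  assumes "0 \<le> \<gamma>"
  shows "loss \<gamma> (\<lambda>x. ip d w x) (noise_distr d)
       = (1 + measure_pmf.prob (cube_pmf d) {x. \<bar>ip d w x\<bar> \<le> \<gamma>}) / 2"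
proof -
  let ?P = "measure_pmf.prob (cube_pmf d)"
  let ?E = "{a. (if snd a then 1 else - 1) * ip d w (fst a) \<le> \<gamma>}"
  have "loss \<gamma> (\<lambda>x. ip d w x) (noise_distr d) = measure_pmf.expectation (noise_pmf d) (indicator ?E)"
    by (simp add: noise_distr_def loss_labelled)
  also have "\<dots> = (measure_pmf.expectation (cube_pmf d) (\<lambda>x. indicator ?E (x, True))
      + measure_pmf.expectation (cube_pmf d) (\<lambda>x. indicator ?E (x, False))) / 2"
    unfolding noise_pmf_def
    by (subst expectation_pair_pmf_finite) (simp_all add: add_divide_distrib)
  also have "\<dots> = (measure_pmf.expectation (cube_pmf d) (indicator {x. ip d w x \<le> \<gamma>})
      + measure_pmf.expectation (cube_pmf d) (indicator {x. - ip d w x \<le> \<gamma>})) / 2"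
    by (intro arg_cong2[where f="\<lambda>a b. (a + b) / 2"] Bochner_Integration.integral_cong refl)
      (auto simp: indicator_def)
  also have "\<dots> = (?P {x. ip d w x \<le> \<gamma>} + ?P {x. - ip d w x \<le> \<gamma>}) / 2"
    by simp
  also have "{x. ip d w x \<le> \<gamma>} = {x. ip d w x < - \<gamma>} \<union> {x. \<bar>ip d w x\<bar> \<le> \<gamma>}"
    using assms by auto
  also have "?P \<dots> = ?P {x. ip d w x < - \<gamma>} + ?P {x. \<bar>ip d w x\<bar> \<le> \<gamma>}"
    by (rule measure_pmf.finite_measure_Union) auto
  also have "{x. - ip d w x \<le> \<gamma>} = space (measure_pmf (cube_pmf d)) - {x. ip d w x < - \<gamma>}"
    by auto
  also have "?P \<dots> = 1 - ?P {x. ip d w x < - \<gamma>}"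
    by (rule measure_pmf.prob_compl) simp
  finally show ?thesis by simp
qed

lemma loss_nonneg: "0 \<le> loss \<gamma> h D"
  by (simp add: loss_def)

lemma W_nonempty: "W d \<noteq> {}"
  by (auto simp: W_def intro!: exI[of _ "\<lambda>_. 0"])

lemma opt_loss_le: "h \<in> W d \<Longrightarrow> opt_loss d \<gamma> D \<le> loss \<gamma> h D"
  unfolding opt_loss_def
  by (rule cINF_lower) (auto intro!: bdd_belowI[of _ 0] loss_nonneg)

text \<open>Chebyshev's inequality at threshold 1 leaves probability at least \<open>19/64\<close>
  within the margin, and \<open>(1 + 19/64) / 2 = 83/128\<close>.\<close>

lemma opt_loss_noise_distr: "83/128 \<le> opt_loss d 1 (noise_distr d)"
  unfolding opt_loss_def
proof (rule cINF_greatest[OF W_nonempty])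
  fix h assume "h \<in> W d"
  then obtain w where h: "h = (\<lambda>x. ip d w x)" and w: "(\<Sum>i<d. (w i)\<^sup>2) \<le> 1"
    by (auto simp: W_def)
  let ?P = "measure_pmf.prob (cube_pmf d)"
  have "?P {x. 1 < \<bar>ip d w x\<bar>} \<le> 45/64"
    using prob_abs_ip_gt[of 1 d w] w by simp
  moreover have "{x. \<bar>ip d w x\<bar> \<le> 1} = space (measure_pmf (cube_pmf d)) - {x. 1 < \<bar>ip d w x\<bar>}"
    by auto
  then have "?P {x. \<bar>ip d w x\<bar> \<le> 1} = 1 - ?P {x. 1 < \<bar>ip d w x\<bar>}"
    using measure_pmf.prob_compl[of "{x. 1 < \<bar>ip d w x\<bar>}" "cube_pmf d"] by simp
  ultimately show "83/128 \<le> loss 1 h (noise_distr d)"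
    by (simp add: h loss_noise_distr)
qed

lemma loss_0_noise_distr:
  assumes "i < d" "w i \<noteq> 0"
  shows "loss 0 (\<lambda>x. ip d w x) (noise_distr d) \<le> 5/8"
  using prob_ip_eq_0[of i d w, OF assms] by (simp add: loss_noise_distr)

section \<open>Outer probability and empirical loss\<close>

lemma outer_prob_le:
  "A \<in> sets M \<Longrightarrow> E \<subseteq> A \<Longrightarrow> outer_prob M E \<le> measure M A"
  unfolding outer_prob_def by (rule cINF_lower) (auto intro!: bdd_belowI[of _ 0])

text \<open>The assumption \<open>E \<subseteq> space M\<close> supplies a cover, so the infimum is
  not over the empty set.\<close>

lemma outer_prob_ge:
  assumes "E \<subseteq> space M" "\<And>A. A \<in> sets M \<Longrightarrow> E \<subseteq> A \<Longrightarrow> c \<le> measure M A"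
  shows "c \<le> outer_prob M E"
  unfolding outer_prob_def using assms by (intro cINF_greatest) auto

lemma err_alg_le:
  assumes "0 \<le> e"
    "outer_prob (PiM {..<n} (\<lambda>_. D)) {S \<in> space (PiM {..<n} (\<lambda>_. D)). loss 0 (A n S) D \<ge> e} \<le> \<delta>"
  shows "err_alg A D n \<delta> \<le> e"
  unfolding err_alg_def by (rule cInf_lower) (use assms in \<open>auto intro!: bdd_belowI[of _ 0]\<close>)

lemma emp_loss_nonneg: "0 \<le> emp_loss \<gamma> h n S"
  by (simp add: emp_loss_def)

lemma emp_loss_eq_1:
  assumes "0 < n" "\<And>i. i < n \<Longrightarrow> snd (S i) * h (fst (S i)) \<le> \<gamma>"
  shows "emp_loss \<gamma> h n S = 1"
proof -
  have "{i \<in> {..<n}. snd (S i) * h (fst (S i)) \<le> \<gamma>} = {..<n}"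
    using assms by auto
  then show ?thesis
    using assms by (simp add: emp_loss_def)
qed

lemma emp_loss_less_1:
  assumes "i < n" "\<not> snd (S i) * h (fst (S i)) \<le> \<gamma>"
  shows "emp_loss \<gamma> h n S < 1"
proof -
  have "{i \<in> {..<n}. snd (S i) * h (fst (S i)) \<le> \<gamma>} \<subset> {..<n}"
    using assms by auto
  then have "card {i \<in> {..<n}. snd (S i) * h (fst (S i)) \<le> \<gamma>} < card {..<n}"
    by (rule psubset_card_mono[rotated]) simp
  then have "real (card {i \<in> {..<n}. snd (S i) * h (fst (S i)) \<le> \<gamma>}) < real n"
    by simp
  then show ?thesis
    unfolding emp_loss_def by (subst divide_less_eq_1_pos) (use assms in auto)
qed

lemma ip_first_coord: "0 < d \<Longrightarrow> ip d (\<lambda>i. if i = 0 then c else 0) x = c * x 0"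
proof -
  assume d: "0 < d"
  have "ip d (\<lambda>i. if i = 0 then c else 0) x = (\<Sum>i<d. if i = 0 then c * x 0 else 0)"
    unfolding ip_def by (intro sum.cong) auto
  with d show ?thesis by simp
qed

lemma first_coord_in_W:
  assumes "\<bar>c\<bar> \<le> 1"
  shows "(\<lambda>x. ip d (\<lambda>i. if i = 0 then c else 0) x) \<in> W d"
proof -
  have "(\<Sum>i<d. (if i = 0 then c else 0 :: real)\<^sup>2) = (\<Sum>i<d. if i = 0 then c\<^sup>2 else 0)"
    by (intro sum.cong) auto
  also have "\<dots> \<le> 1"
    using assms by (simp add: abs_square_le_1)
  finally show ?thesis
    by (auto simp: W_def)
qed

text \<open>The zero vector misses the margin everywhere and has empirical loss 1, while a signed
  unit vector along coordinate 0 attains the margin at point \<open>i\<close>. So a minimiser is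
  nonzero.\<close>

lemma mem_alg_noise_loss:
  assumes A: "mem_alg d 1 A" and S: "\<And>i. i < n \<Longrightarrow> S i \<in> space (Zd d)"
    and i: "i < n" "1 < \<bar>fst (S i) 0\<bar>" and d: "0 < d"
  shows "loss 0 (A n S) (noise_distr d) \<le> 5/8"
proof -
  obtain w where w: "A n S = (\<lambda>x. ip d w x)" and "A n S \<in> W d"
    and min: "\<And>h. h \<in> W d \<Longrightarrow> emp_loss 1 (A n S) n S \<le> emp_loss 1 h n S"
    using A S unfolding mem_alg_def W_def by blast
  have "\<exists>j<d. w j \<noteq> 0"
  proof (rule ccontr)
    assume "\<not> (\<exists>j<d. w j \<noteq> 0)"
    then have w0: "emp_loss 1 (A n S) n S = 1"
      using i by (intro emp_loss_eq_1) (auto simp: w ip_def)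
    define c where "c = snd (S i) * sgn (fst (S i) 0)"
    define h where "h = (\<lambda>x. ip d (\<lambda>i. if i = 0 then c else 0) x)"
    have y: "snd (S i) = 1 \<or> snd (S i) = - 1"
      using S[OF i(1)] unfolding space_Zd mem_Times_iff by blast
    then have "snd (S i) * h (fst (S i)) = \<bar>fst (S i) 0\<bar>"
      unfolding h_def ip_first_coord[OF d] c_def by (elim disjE) (simp_all add: sgn_if abs_if)
    then have "emp_loss 1 h n S < 1"
      using i by (intro emp_loss_less_1[OF i(1)]) simp
    moreover have "\<bar>c\<bar> \<le> 1"
      using y unfolding c_def sgn_if by (elim disjE) simp_all
    then have "h \<in> W d"
      unfolding h_def by (rule first_coord_in_W)
    ultimately show False
      using min[of h] w0 by linarith
  qed
  then obtain j where "j < d" "w j \<noteq> 0"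
    by blast
  then show ?thesis
    unfolding w by (rule loss_0_noise_distr)
qed

lemma half_power_le:
  assumes "0 < \<delta>" "log 2 (1 / \<delta>) \<le> real n"
  shows "(1/2) ^ n \<le> (\<delta> :: real)"
proof -
  have "1 / \<delta> = 2 powr (log 2 (1 / \<delta>))"
    by (rule powr_log_cancel[symmetric]) (use assms in auto)
  also have "\<dots> \<le> 2 powr real n"
    by (rule powr_mono) (use assms in auto)
  also have "\<dots> = 2 ^ n"
    by (rule powr_realpow) simp
  finally have "1 / 2 ^ n \<le> \<delta>"
    using assms by (simp add: divide_le_eq mult.commute)
  then show ?thesis
    by (simp add: power_one_over)
qed

lemma prob_noise_sample_small:
  assumes d: "0 < d"
  shows "measure (PiM {..<n} (\<lambda>_. noise_distr d)) (PiE {..<n} (\<lambda>_. {z \<in> space (Zd d). \<bar>fst z 0\<bar> \<le> 1})) = (1/2) ^ n"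
    and "PiE {..<n} (\<lambda>_. {z \<in> space (Zd d). \<bar>fst z 0\<bar> \<le> 1}) \<in> sets (PiM {..<n} (\<lambda>_. noise_distr d))"
proof -
  let ?D = "noise_distr d"
  let ?B = "{z \<in> space (Zd d). \<bar>fst z 0\<bar> \<le> 1}"
  have B: "?B \<in> sets (Zd d)"
    by (intro borel_measurable_le borel_measurable_abs measurable_coord_Zd d) simp
  then have BD: "?B \<in> sets ?D"
    by (simp add: noise_distr_def)
  then show "PiE {..<n} (\<lambda>_. ?B) \<in> sets (PiM {..<n} (\<lambda>_. ?D))"
    by (intro sets_PiM_I_finite) auto
  have PB: "measure ?D ?B = 1/2"
  proof -
    have "measure ?D ?B = measure_pmf.prob (noise_pmf d) {a. \<bar>fst a 0\<bar> \<le> 1}"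
      using d unfolding noise_distr_def measure_labelled[OF B] by simp
    also have "\<dots> = measure_pmf.prob (map_pmf fst (noise_pmf d)) {x. \<bar>x 0\<bar> \<le> 1}"
      by (simp add: measure_map_pmf vimage_def)
    finally show ?thesis
      using d by (simp add: map_fst_noise_pmf prob_abs_first_coord_le_1)
  qed
  interpret D: prob_space ?D
    by (simp add: noise_distr_def prob_space_labelled)
  have sf: "product_sigma_finite (\<lambda>_::nat. ?D)"
    by (simp add: product_sigma_finite_def D.sigma_finite_measure_axioms)
  have "emeasure (PiM {..<n} (\<lambda>_. ?D)) (PiE {..<n} (\<lambda>_. ?B)) = (\<Prod>i<n. emeasure ?D ?B)"
    by (rule product_sigma_finite.emeasure_PiM[OF sf]) (use BD in auto)
  also have "\<dots> = (\<Prod>i<n. ennreal (1/2))"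
    by (simp only: D.emeasure_eq_measure PB)
  also have "\<dots> = ennreal (\<Prod>i<n. 1/2)"
    by (rule prod_ennreal) simp
  also have "\<dots> = ennreal ((1/2) ^ n)"
    by (simp only: prod_constant card_lessThan)
  finally show "measure (PiM {..<n} (\<lambda>_. ?D)) (PiE {..<n} (\<lambda>_. ?B)) = (1/2) ^ n"
    by (rule measure_eq_emeasure_eq_ennreal[rotated]) simp
qed

text \<open>The level \<open>83/128\<close> is above the error \<open>5/8\<close> of nonzero vectors
  and not above the optimal margin loss. Reaching it requires every sampled first coordinate to be
  small, and the resulting excess is at most zero, whatever \<open>\<epsilon>\<close> is.\<close>

lemma sc_good_noise_distr:
  assumes d: "0 < d" and \<epsilon>: "0 < \<epsilon>" and \<delta>: "0 < \<delta>" and m0: "log 2 (1 / \<delta>) \<le> real m0"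
  shows "sc_good d \<epsilon> 1 (noise_distr d) \<delta> m0"
  unfolding sc_good_def
proof (intro allI impI)
  fix A n
  assume A: "mem_alg d 1 A" and n: "m0 \<le> n"
  let ?D = "noise_distr d"
  let ?M = "PiM {..<n} (\<lambda>_. noise_distr d)"
  let ?B = "{z \<in> space (Zd d). \<bar>fst z 0\<bar> \<le> 1}"
  have spM: "space ?M = PiE {..<n} (\<lambda>_. space (Zd d))"
    by (simp add: space_PiM noise_distr_def)
  have "{S \<in> space ?M. loss 0 (A n S) ?D \<ge> 83/128} \<subseteq> PiE {..<n} (\<lambda>_. ?B)"
  proof
    fix S assume "S \<in> {S \<in> space ?M. loss 0 (A n S) ?D \<ge> 83/128}"
    then have S: "S \<in> PiE {..<n} (\<lambda>_. space (Zd d))" and bad: "loss 0 (A n S) ?D \<ge> 83/128"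
      by (simp_all add: spM)
    have Si: "S i \<in> space (Zd d)" if "i < n" for i
      by (rule PiE_mem[OF S]) (simp add: that)
    have "\<bar>fst (S i) 0\<bar> \<le> 1" if i: "i < n" for i
    proof (rule ccontr)
      assume "\<not> \<bar>fst (S i) 0\<bar> \<le> 1"
      then have "loss 0 (A n S) ?D \<le> 5/8"
        using mem_alg_noise_loss[OF A Si i _ d] by simp
      with bad show False by linarith
    qed
    then show "S \<in> PiE {..<n} (\<lambda>_. ?B)"
      using S Si by (simp only: PiE_iff mem_Collect_eq lessThan_iff) blast
  qed
  then have "outer_prob ?M {S \<in> space ?M. loss 0 (A n S) ?D \<ge> 83/128} \<le> measure ?M (PiE {..<n} (\<lambda>_. ?B))"
    by (rule outer_prob_le[OF prob_noise_sample_small(2)[OF d]])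
  also have "\<dots> = (1/2) ^ n"
    by (rule prob_noise_sample_small(1)[OF d])
  also have "\<dots> \<le> \<delta>"
    using m0 n \<delta> by (intro half_power_le) auto
  finally have "err_alg A ?D n \<delta> \<le> 83/128"
    by (intro err_alg_le) auto
  then show "err_alg A ?D n \<delta> - opt_loss d 1 ?D \<le> \<epsilon>"
    using opt_loss_noise_distr[of d] \<epsilon> by linarith
qed

lemma samp_compl_noise_distr:
  assumes "0 < d" "0 < \<epsilon>" "0 < \<delta>" "\<delta> < 1"
  shows "samp_compl d \<epsilon> 1 (noise_distr d) \<delta> \<le> ereal (real_of_int \<lceil>log 2 (1 / \<delta>)\<rceil>)"
proof -
  define m0 where "m0 = nat \<lceil>log 2 (1 / \<delta>)\<rceil>"
  \<comment> \<open>Ensures that \<open>nat\<close> does not truncate the ceiling.\<close>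
  have "0 \<le> log 2 (1 / \<delta>)"
    using assms by simp
  then have "real m0 = real_of_int \<lceil>log 2 (1 / \<delta>)\<rceil>"
    unfolding m0_def by (intro of_nat_nat) linarith
  moreover from this have "sc_good d \<epsilon> 1 (noise_distr d) \<delta> m0"
    using assms by (intro sc_good_noise_distr) auto
  ultimately show ?thesis
    using Least_le[of "sc_good d \<epsilon> 1 (noise_distr d) \<delta>" m0] by (auto simp: samp_compl_def)
qed

section \<open>Lower bound for sign labels\<close>

lemma opt_loss_sign_distr:
  assumes d: "0 < d"
  shows "opt_loss d 1 (sign_distr d) \<le> 1/2"
proof -
  have "opt_loss d 1 (sign_distr d) \<le> loss 1 (\<lambda>x. ip d (\<lambda>i. if i = 0 then 1 else 0) x) (sign_distr d)"
    by (intro opt_loss_le first_coord_in_W) simp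
  also have "\<dots> = measure_pmf.prob (cube_pmf d) {x. \<bar>x 0\<bar> \<le> 1}"
    unfolding sign_distr_def loss_labelled
    by (intro arg_cong[where f="measure_pmf.prob (cube_pmf d)"]) (auto simp: ip_first_coord[OF d])
  finally show ?thesis
    using d by (simp add: prob_abs_first_coord_le_1)
qed

definition sign_sample :: "nat \<Rightarrow> nat \<Rightarrow> (nat \<Rightarrow> point) \<Rightarrow> sample" where
  "sign_sample d n S = (\<lambda>i\<in>{..<n}. (restrict (S i) {..<d}, if 0 \<le> S i 0 then 1 else - 1))"

lemma ip_upd_first:
  assumes "0 < d" "u 0 = 0"
  shows "ip d (u(0 := c)) x = ip d u x + c * x 0"
proof -
  have "u(0 := c) = (\<lambda>i. u i + (if i = 0 then c else 0))"
    using assms by auto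
  then show ?thesis
    using ip_first_coord[OF assms(1), of c x] by (simp add: ip_add_left)
qed

text \<open>On the sample the margin is \<open>2 - \<bar>x 0\<bar> / 2\<close>, at least
  \<open>2 - 9/16 > 1\<close>. On a fresh point the term \<open>- x 0 / 2\<close> has the wrong sign
  and size at least \<open>3/16\<close>, which usually dominates \<open>ip d u x\<close>.\<close>

lemma bad_minimiser:
  assumes d: "0 < d" and cost: "interp_cost d (\<lambda>x. 2 * (if 0 \<le> x 0 then 1 else - 1)) n S < 1"
    and S: "\<And>i. i < n \<Longrightarrow> S i \<in> set_pmf (cube_pmf d)"
  shows "\<exists>h\<in>W d. emp_loss 1 h n (sign_sample d n S) = 0 \<and> 3/4 \<le> loss 0 h (sign_distr d)"
proof -
  obtain u where u: "u \<in> interpolants d (\<lambda>x. 2 * (if 0 \<le> x 0 then 1 else - 1)) n S"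
    and uu: "80 * ip d u u < 1"
    using interp_cost_less[OF cost] by auto
  then have u0: "u 0 = 0"
    by (simp add: interpolants_def)
  define w where "w = u(0 := - 1/2)"
  have ipw: "ip d w x = ip d u x - x 0 / 2" for x
    using ip_upd_first[OF d, of u "- 1/2" x] u0 by (simp add: w_def)
  have "w 0 = - 1/2"
    by (simp add: w_def)
  then have "ip d w w = ip d u u + 1/4"
    using ipw[of w] ipw[of u] u0 ip_commute[of d u w] by linarith
  then have "(\<lambda>x. ip d w x) \<in> W d"
    using uu by (auto simp: W_def ip_self[symmetric] intro!: exI[of _ w])
  moreover have "emp_loss 1 (\<lambda>x. ip d w x) n (sign_sample d n S) = 0"
  proof -
    have "\<not> snd (sign_sample d n S i) * ip d w (fst (sign_sample d n S i)) \<le> 1" if i: "i < n" for i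
    proof -
      have "S i 0 \<in> {- 9/8, - 3/8, 3/8, 9/8}"
        using S[OF i] d by (auto simp: cube_pmf_def set_Pi_pmf PiE_dflt_def set_coord_pmf)
      moreover have "ip d u (S i) = 2 * (if 0 \<le> S i 0 then 1 else - 1)"
        using u i by (simp add: interpolants_def)
      ultimately show ?thesis
        using i by (auto simp: sign_sample_def ipw)
    qed
    then have "{i \<in> {..<n}. snd (sign_sample d n S i) * ip d w (fst (sign_sample d n S i)) \<le> 1} = {}"
      by auto
    then show ?thesis
      by (simp only: emp_loss_def) simp
  qed
  moreover have "3/4 \<le> loss 0 (\<lambda>x. ip d w x) (sign_distr d)"
  proof -
    let ?P = "measure_pmf.prob (cube_pmf d)"
    have "?P {x. 3/16 < \<bar>ip d u x\<bar>} \<le> 45/64 * ip d u u / (3/16)\<^sup>2"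
      using prob_abs_ip_gt[of "3/16" d u] by (simp add: ip_self)
    \<comment> \<open>This fixes the scale \<open>80\<close> in \<open>interp_cost\<close>:
      \<open>45/64 * (1/80) / (3/16)^2\<close> equals \<open>1/4\<close>.\<close>
    also have "\<dots> \<le> 1/4"
      using uu by (simp add: power2_eq_square)
    finally have "3/4 \<le> ?P (space (measure_pmf (cube_pmf d)) - {x. 3/16 < \<bar>ip d u x\<bar>})"
      by (subst measure_pmf.prob_compl) auto
    also have "\<dots> \<le> ?P {x. (if 0 \<le> x 0 then 1 else - 1) * ip d w x \<le> 0}"
    proof (rule measure_pmf.finite_measure_mono_AE)
      show "AE x in measure_pmf (cube_pmf d).
          x \<in> space (measure_pmf (cube_pmf d)) - {x. 3/16 < \<bar>ip d u x\<bar>} \<longrightarrow>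
          x \<in> {x. (if 0 \<le> x 0 then 1 else - 1) * ip d w x \<le> 0}"
      proof (rule AE_pmfI)
        fix x assume "x \<in> set_pmf (cube_pmf d)"
        then have "x 0 \<in> {- 9/8, - 3/8, 3/8, 9/8}"
          using d by (auto simp: cube_pmf_def set_Pi_pmf PiE_dflt_def set_coord_pmf)
        then show "x \<in> space (measure_pmf (cube_pmf d)) - {x. 3/16 < \<bar>ip d u x\<bar>} \<longrightarrow>
          x \<in> {x. (if 0 \<le> x 0 then 1 else - 1) * ip d w x \<le> 0}"
          by (auto simp: ipw)
      qed
    qed simp
    finally show ?thesis
      by (simp add: sign_distr_def loss_labelled)
  qed
  ultimately show ?thesis
    by blast
qed

section \<open>Adversarial choice of minimisers\<close>

definition minimisers :: "nat \<Rightarrow> real \<Rightarrow> nat \<Rightarrow> sample \<Rightarrow> hyp set" where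
  "minimisers d \<gamma> n S = {h \<in> W d. \<forall>g\<in>W d. emp_loss \<gamma> h n S \<le> emp_loss \<gamma> g n S}"

text \<open>\<open>W d\<close> may be infinite, but the number of margin errors is a natural number
  and so attains its least value.\<close>

lemma minimisers_nonempty: "minimisers d \<gamma> n S \<noteq> {}"
proof -
  obtain h0 where "h0 \<in> W d"
    using W_nonempty by blast
  then obtain h where "h \<in> W d"
    "\<And>g. g \<in> W d \<Longrightarrow> card {i \<in> {..<n}. snd (S i) * h (fst (S i)) \<le> \<gamma>}
       \<le> card {i \<in> {..<n}. snd (S i) * g (fst (S i)) \<le> \<gamma>}"
    using ex_has_least_nat[of "\<lambda>h. h \<in> W d" h0 "\<lambda>h. card {i \<in> {..<n}. snd (S i) * h (fst (S i)) \<le> \<gamma>}"]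
    by blast
  then have "h \<in> minimisers d \<gamma> n S"
    by (auto simp: minimisers_def emp_loss_def intro!: divide_right_mono)
  then show ?thesis by blast
qed

text \<open>Ties between minimisers are broken against the distribution \<open>D\<close>. This is
  legitimate because sample complexity quantifies over all algorithms; the last branch keeps the
  output a minimiser on every sample.\<close>

definition worst_alg :: "nat \<Rightarrow> real \<Rightarrow> example measure \<Rightarrow> real \<Rightarrow> alg" where
  "worst_alg d \<gamma> D c n S =
     (if \<exists>h\<in>minimisers d \<gamma> n S. c \<le> loss 0 h D
      then SOME h. h \<in> minimisers d \<gamma> n S \<and> c \<le> loss 0 h D
      else SOME h. h \<in> minimisers d \<gamma> n S)"

lemma worst_alg_in_minimisers: "worst_alg d \<gamma> D c n S \<in> minimisers d \<gamma> n S"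
proof (cases "\<exists>h\<in>minimisers d \<gamma> n S. c \<le> loss 0 h D")
  case True
  then show ?thesis
    using someI_ex[of "\<lambda>h. h \<in> minimisers d \<gamma> n S \<and> c \<le> loss 0 h D"]
    by (auto simp: worst_alg_def)
next
  case False
  then show ?thesis
    using minimisers_nonempty[of d \<gamma> n S] by (auto simp: worst_alg_def some_in_eq)
qed

lemma mem_alg_worst_alg: "mem_alg d \<gamma> (worst_alg d \<gamma> D c)"
  using worst_alg_in_minimisers by (auto simp: mem_alg_def minimisers_def)

lemma loss_worst_alg:
  assumes "h \<in> minimisers d \<gamma> n S" "c \<le> loss 0 h D"
  shows "c \<le> loss 0 (worst_alg d \<gamma> D c n S) D"
  using assms someI_ex[of "\<lambda>h. h \<in> minimisers d \<gamma> n S \<and> c \<le> loss 0 h D"]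
  by (auto simp: worst_alg_def)

lemma loss_le_1: "prob_space D \<Longrightarrow> loss \<gamma> h D \<le> 1"
  unfolding loss_def by (rule prob_space.prob_le_1)

text \<open>No level below \<open>c\<close> is admissible. Level 2 always is, since losses are
  probabilities, and this excludes the default value of \<open>Inf\<close> on the empty set.\<close>

lemma err_alg_ge:
  assumes D: "prob_space D" and "0 \<le> \<delta>"
    and c: "\<And>e. e < c \<Longrightarrow>
      \<delta> < outer_prob (PiM {..<n} (\<lambda>_. D)) {S \<in> space (PiM {..<n} (\<lambda>_. D)). loss 0 (A n S) D \<ge> e}"
  shows "c \<le> err_alg A D n \<delta>"
  unfolding err_alg_def
proof (rule cInf_greatest)
  let ?M = "PiM {..<n} (\<lambda>_. D)"
  have empty: "{S \<in> space ?M. loss 0 (A n S) D \<ge> 2} = {}"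
  proof -
    have False if "2 \<le> loss 0 (A n S) D" for S
      using loss_le_1[OF D, of 0 "A n S"] that by linarith
    then show ?thesis by blast
  qed
  have "outer_prob ?M {} \<le> \<delta>"
    using outer_prob_le[of "{}" ?M "{}"] assms(2) by simp
  then have "2 \<in> {\<epsilon>. 0 \<le> \<epsilon> \<and> outer_prob ?M {S \<in> space ?M. \<epsilon> \<le> loss 0 (A n S) D} \<le> \<delta>}"
    unfolding mem_Collect_eq empty by simp
  then show "{\<epsilon>. 0 \<le> \<epsilon> \<and> outer_prob ?M {S \<in> space ?M. \<epsilon> \<le> loss 0 (A n S) D} \<le> \<delta>} \<noteq> {}"
    by blast
qed (use c in \<open>force simp: not_le[symmetric]\<close>)

text \<open>Every measurable cover of the error event pulls back to a set that contains, up to a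
  null set, the samples of cost below 1, and these have probability at least
  \<open>1/2\<close>.\<close>

lemma err_worst_alg_sign_distr:
  assumes d: "0 < d" and n: "20000 * n \<le> d" and \<delta>: "0 \<le> \<delta>" "\<delta> < 1/2"
  shows "3/4 \<le> err_alg (worst_alg d 1 (sign_distr d) (3/4)) (sign_distr d) n \<delta>"
proof (rule err_alg_ge)
  let ?D = "sign_distr d" and ?A = "worst_alg d 1 (sign_distr d) (3/4)"
  let ?M = "PiM {..<n} (\<lambda>_. ?D)"
  let ?\<tau> = "\<lambda>x :: point. 2 * (if 0 \<le> x 0 then 1 else - 1 :: real)"
  let ?Q = "sample_pmf d n"
  show "prob_space ?D"
    by (simp add: sign_distr_def prob_space_labelled)
  show "0 \<le> \<delta>" by fact
  fix e :: real
  assume e: "e < 3/4"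
  let ?E = "{S \<in> space ?M. loss 0 (?A n S) ?D \<ge> e}"
  have samples: "?M = distr (measure_pmf ?Q) ?M (sign_sample d n)"
    unfolding sign_distr_def sample_pmf_def sign_sample_def by (rule PiM_labelled)
  have meas: "sign_sample d n \<in> measure_pmf ?Q \<rightarrow>\<^sub>M ?M"
    by (auto simp: sign_distr_def space_PiM sign_sample_def)
  have "1/2 \<le> outer_prob ?M ?E"
  proof (rule outer_prob_ge)
    fix B assume B: "B \<in> sets ?M" "?E \<subseteq> B"
    have "1/2 \<le> measure_pmf.prob ?Q {S. interp_cost d ?\<tau> n S < 1}"
      using d n by (intro prob_interp_cost_less_1) auto
    also have "\<dots> \<le> measure_pmf.prob ?Q (sign_sample d n -` B)"
    \<comment> \<open>The inclusion holds only almost everywhere, as \<open>bad_minimiser\<close>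
      needs sample points in the support.\<close>
    proof (rule measure_pmf.finite_measure_mono_AE)
      show "AE S in measure_pmf ?Q. S \<in> {S. interp_cost d ?\<tau> n S < 1} \<longrightarrow> S \<in> sign_sample d n -` B"
      proof (rule AE_pmfI, rule impI)
        fix S assume S: "S \<in> set_pmf ?Q" "S \<in> {S. interp_cost d ?\<tau> n S < 1}"
        have "S i \<in> set_pmf (cube_pmf d)" if "i < n" for i
          using S(1) that by (auto simp: sample_pmf_def set_Pi_pmf PiE_dflt_def)
        then obtain h where h: "h \<in> W d" "emp_loss 1 h n (sign_sample d n S) = 0" "3/4 \<le> loss 0 h ?D"
          using bad_minimiser[OF d, of n S] S(2) by auto
        then have "h \<in> minimisers d 1 n (sign_sample d n S)"
          by (auto simp: minimisers_def emp_loss_nonneg)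
        then have "3/4 \<le> loss 0 (?A n (sign_sample d n S)) ?D"
          using h by (rule_tac loss_worst_alg)
        moreover have "sign_sample d n S \<in> space ?M"
          using measurable_space[OF meas, of S] by simp
        ultimately have "sign_sample d n S \<in> ?E"
          using e by simp
        then show "S \<in> sign_sample d n -` B"
          using B by blast
      qed
    qed simp
    also have "\<dots> = measure (distr (measure_pmf ?Q) ?M (sign_sample d n)) B"
      using measure_distr[OF meas B(1)] by simp
    also have "\<dots> = measure ?M B"
      by (simp only: samples[symmetric])
    finally show "1/2 \<le> measure ?M B" .
  qed auto
  with \<delta> show "\<delta> < outer_prob ?M ?E"
    by linarith
qed

text \<open>For sample sizes up to \<open>d / 20000\<close> the excess error is at least
  \<open>3/4 - 1/2 = 1/4 > \<epsilon>\<close>. If no size is good, the sample complexity is infinite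
  and the bound is trivial.\<close>

lemma samp_compl_sign_distr:
  assumes d: "0 < d" and \<epsilon>: "\<epsilon> < 1/4" and \<delta>: "0 < \<delta>" "\<delta> < 1/4"
  shows "ereal (1/20000 * real d) \<le> samp_compl d \<epsilon> 1 (sign_distr d) \<delta>"
proof -
  let ?good = "sc_good d \<epsilon> 1 (sign_distr d) \<delta>"
  have large: "1/20000 * real d \<le> real m" if m: "?good m" for m
  proof (rule ccontr)
    assume "\<not> 1/20000 * real d \<le> real m"
    then have "20000 * m \<le> d"
      by simp
    then have "3/4 \<le> err_alg (worst_alg d 1 (sign_distr d) (3/4)) (sign_distr d) m \<delta>"
      using d \<delta> by (intro err_worst_alg_sign_distr) auto
    moreover have "err_alg (worst_alg d 1 (sign_distr d) (3/4)) (sign_distr d) m \<delta>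
        - opt_loss d 1 (sign_distr d) \<le> \<epsilon>"
      using m mem_alg_worst_alg[of d 1] by (auto simp: sc_good_def)
    ultimately show False
      using opt_loss_sign_distr[OF d] \<epsilon> by linarith
  qed
  show ?thesis
    using large[OF LeastI_ex[of ?good]] by (auto simp: samp_compl_def)
qed

theorem mainTheorem18:
  shows "\<exists>c C'. c > 0 \<and> C' \<ge> 0 \<and>
    (\<forall>d::nat. d > 1 \<longrightarrow>
      (\<exists>D P. is_distr d D \<and> is_distr d P \<and>
         (\<forall>i<d. \<forall>j<d. cov_X D i j = cov_X P i j) \<and>
         (\<forall>\<epsilon> \<delta>. 0 < \<epsilon> \<and> \<epsilon> < 1/4 \<and> 0 < \<delta> \<and> \<delta> < 1/4 \<longrightarrow>
            samp_compl d \<epsilon> 1 P \<delta> \<ge> ereal (c * real d - C') \<and>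
            samp_compl d \<epsilon> 1 D \<delta> \<le> ereal (real_of_int \<lceil>log 2 (1 / \<delta>)\<rceil>)) \<and>
         (\<forall>u. subgauss_rel D (\<lambda>z. ip d u (fst z)) (sqrt 2) \<and>
              subgauss_rel P (\<lambda>z. ip d u (fst z)) (sqrt 2))))"
proof -
  have main: "is_distr d (noise_distr d) \<and> is_distr d (sign_distr d) \<and>
      (\<forall>i<d. \<forall>j<d. cov_X (noise_distr d) i j = cov_X (sign_distr d) i j) \<and>
      (\<forall>\<epsilon> \<delta>. 0 < \<epsilon> \<and> \<epsilon> < 1/4 \<and> 0 < \<delta> \<and> \<delta> < 1/4 \<longrightarrow>
         samp_compl d \<epsilon> 1 (sign_distr d) \<delta> \<ge> ereal (1/20000 * real d - 0) \<and>
         samp_compl d \<epsilon> 1 (noise_distr d) \<delta> \<le> ereal (real_of_int \<lceil>log 2 (1 / \<delta>)\<rceil>)) \<and>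
      (\<forall>u. subgauss_rel (noise_distr d) (\<lambda>z. ip d u (fst z)) (sqrt 2) \<and>
           subgauss_rel (sign_distr d) (\<lambda>z. ip d u (fst z)) (sqrt 2))"
    if d: "d > 1" for d :: nat
  proof (intro conjI allI impI)
    show "is_distr d (noise_distr d)" "is_distr d (sign_distr d)"
      by (simp_all add: noise_distr_def sign_distr_def is_distr_labelled)
    show "cov_X (noise_distr d) i j = cov_X (sign_distr d) i j" if "i < d" "j < d" for i j
      using that map_fst_noise_pmf[of d]
      by (simp add: noise_distr_def sign_distr_def cov_X_labelled[where q = "cube_pmf d"])
    show "subgauss_rel (noise_distr d) (\<lambda>z. ip d u (fst z)) (sqrt 2)"
      "subgauss_rel (sign_distr d) (\<lambda>z. ip d u (fst z)) (sqrt 2)" for u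
      unfolding noise_distr_def sign_distr_def
      by (intro subgauss_rel_labelled; simp add: map_fst_noise_pmf finite_set_noise_pmf)+
    fix \<epsilon> \<delta> :: real
    assume "0 < \<epsilon> \<and> \<epsilon> < 1/4 \<and> 0 < \<delta> \<and> \<delta> < 1/4"
    then show "samp_compl d \<epsilon> 1 (sign_distr d) \<delta> \<ge> ereal (1/20000 * real d - 0)"
      "samp_compl d \<epsilon> 1 (noise_distr d) \<delta> \<le> ereal (real_of_int \<lceil>log 2 (1 / \<delta>)\<rceil>)"
      using d samp_compl_sign_distr[of d \<epsilon> \<delta>] samp_compl_noise_distr[of d \<epsilon> \<delta>] by auto
  qed
  show ?thesis
    by (rule exI[of _ "1/20000"], rule exI[of _ 0], (rule conjI, simp)+,
        rule allI, rule impI, rule exI, rule exI, erule main)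
qed

end
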